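(* Let $G$ and $H$ be nontrivial connected graphs, not both of which are complete graphs. Let (E) denote the following condition: either $G$ is a star and every spanning tree of $H$ has radius at least $3$, or $H$ is a star and every spanning tree of $G$ has radius at least $3$. Then: (i) if (E) does not hold, then $pc_{1,2}(G\square H)=3$; (ii) if (E) holds, then $pc_{1,2}(G\square H)\leq 4$.
   Context: All graphs are finite, undirected and simple; a graph is nontrivial if it has at least two vertices. A star is a graph $K_{1,r}$ with $r\ge 1$. The radius of a connected graph $F$ is $\min_{x\in V(F)}\max_{y\in V(F)} d(x,y)$. The Cartesian product $G\square H$ has vertex set $V(G)\times V(H)$, and two distinct vertices $(u,v)$ and $(x,y)$ are adjacent if either $ux\in E(G)$ and $v=y$, or $vy\in E(H)$ and $u=x$. An edge-coloring of a graph is an arbitrary map from its edge set to the natural numbers (adjacent edges may share a color). In an edge-colored graph, a path $P$ is a distance $2$-proper path if no two edges of $P$ of the same color appear with fewer than $2$ edges in between on $P$. For a connected graph $F$, $pc_{1,2}(F)$ is the minimum number of colors in an edge-coloring of $F$ such that every pair of distinct vertices of $F$ is connected by at least one distance $2$-proper path. *)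

theory Defs
  imports "Graph_Theory.Graph_Theory"
begin

text \<open>
  Finite simple undirected graphs are the library's \<^locale>\<open>pair_graph\<close>s: finite, loopless
  digraphs with a symmetric set of arcs. The undirected edge joining \<open>u\<close> and \<open>v\<close> is
  represented by the two arcs \<open>(u, v)\<close> and \<open>(v, u)\<close>; colors are attached to the
  set \<open>{u, v}\<close>, so that both arcs carry the same color.
\<close>

definition edge :: "'a \<times> 'a \<Rightarrow> 'a set" where
  "edge e = {fst e, snd e}"

definition edges :: "'a pair_pre_digraph \<Rightarrow> 'a set set" where
  "edges F = edge ` parcs F"

definition nontrivial :: "'a pair_pre_digraph \<Rightarrow> bool" where
  "nontrivial F \<longleftrightarrow> card (pverts F) \<ge> 2"

definition complete_graph :: "'a pair_pre_digraph \<Rightarrow> bool" where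
  "complete_graph F \<longleftrightarrow> (\<exists>n. complete_digraph n (with_proj F))"

definition star_graph :: "'a pair_pre_digraph \<Rightarrow> bool" where
  "star_graph F \<longleftrightarrow> (\<exists>r\<ge>1. complete_bipartite_digraph 1 r (with_proj F))"

definition cartesian_product ::
    "'a pair_pre_digraph \<Rightarrow> 'b pair_pre_digraph \<Rightarrow> ('a \<times> 'b) pair_pre_digraph"
    (infixr \<open>\<box>\<close> 70) where
  "G \<box> H = \<lparr> pverts = pverts G \<times> pverts H,
     parcs = {((u, v), (x, y)).
       (u, v) \<in> pverts G \<times> pverts H \<and> (x, y) \<in> pverts G \<times> pverts H \<and> (u, v) \<noteq> (x, y) \<and>
       ((u, x) \<in> parcs G \<and> v = y \<or> (v, y) \<in> parcs H \<and> u = x)} \<rparr>"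

lemma pair_graph_cartesian_product:
  assumes "pair_graph G" "pair_graph H"
  shows "pair_graph (G \<box> H)"
proof -
  interpret G: pair_graph G by fact
  interpret H: pair_graph H by fact
  have fin: "finite (pverts G \<times> pverts H)"
    by (simp add: G.pair_finite_verts H.pair_finite_verts)
  show ?thesis
  proof
    show "finite (parcs (G \<box> H))"
      by (rule finite_subset[OF _ finite_cartesian_product[OF fin fin]])
         (auto simp: cartesian_product_def)
    show "symmetric (with_proj (G \<box> H))"
      using G.graph_symmetric H.graph_symmetric
      by (auto simp: cartesian_product_def symmetric_def intro!: symI)
  qed (use fin in \<open>auto simp: cartesian_product_def\<close>)
qed

definition distance :: "'a pair_pre_digraph \<Rightarrow> 'a \<Rightarrow> 'a \<Rightarrow> nat" where
  "distance F x y = (LEAST n. \<exists>p. pre_digraph.apath (with_proj F) x p y \<and> length p = n)"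

definition radius :: "'a pair_pre_digraph \<Rightarrow> nat" where
  "radius F = Min ((\<lambda>x. Max ((\<lambda>y. distance F x y) ` pverts F)) ` pverts F)"

text \<open>
  The library's \<^const>\<open>tree\<close> and \<^const>\<open>forest\<close> exclude directed cycles, and hence
  every closed walk \<open>u, v, u\<close> along a single undirected edge. In a symmetric loopless digraph
  the cycles of length at least three are exactly the cycles of the undirected graph.
\<close>

definition undirected_tree :: "'a pair_pre_digraph \<Rightarrow> bool" where
  "undirected_tree T \<longleftrightarrow> pair_graph T \<and> Digraph_Component.connected (with_proj T) \<and>
     \<not> (\<exists>p. pre_digraph.cycle (with_proj T) p \<and> length p \<ge> 3)"

definition undirected_spanning_tree :: "'a pair_pre_digraph \<Rightarrow> 'a pair_pre_digraph \<Rightarrow> bool" where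
  "undirected_spanning_tree T F \<longleftrightarrow> undirected_tree T \<and> spanning (with_proj T) (with_proj F)"

text \<open>
  A path is given by the list of its arcs; \<open>j - i - 1\<close> is the number of edges strictly between
  the \<open>i\<close>-th and the \<open>j\<close>-th edge.
\<close>

definition distance2_proper_path ::
    "'a pair_pre_digraph \<Rightarrow> ('a set \<Rightarrow> nat) \<Rightarrow> 'a \<Rightarrow> ('a \<times> 'a) list \<Rightarrow> 'a \<Rightarrow> bool" where
  "distance2_proper_path F c x p y \<longleftrightarrow> pre_digraph.apath (with_proj F) x p y \<and>
     (\<forall>i j. i < j \<and> j < length p \<and> c (edge (p ! i)) = c (edge (p ! j)) \<longrightarrow> \<not> j - i - 1 < 2)"

definition proper_connecting_coloring :: "'a pair_pre_digraph \<Rightarrow> ('a set \<Rightarrow> nat) \<Rightarrow> bool" where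
  "proper_connecting_coloring F c \<longleftrightarrow>
     (\<forall>x\<in>pverts F. \<forall>y\<in>pverts F. x \<noteq> y \<longrightarrow> (\<exists>p. distance2_proper_path F c x p y))"

text \<open>Values of a coloring outside \<^term>\<open>edges F\<close> are irrelevant.\<close>

definition pc\<^sub>1\<^sub>2 :: "'a pair_pre_digraph \<Rightarrow> nat" where
  "pc\<^sub>1\<^sub>2 F = (LEAST k. \<exists>c. proper_connecting_coloring F c \<and> card (c ` edges F) = k)"

text \<open>
  A coloring that is injective on the edges shows that the minimum is over a nonempty set.
\<close>

lemma ex_proper_connecting_coloring:
  fixes F :: "'a pair_pre_digraph"
  assumes "pair_graph F" and "Digraph_Component.connected (with_proj F)"
  shows "\<exists>c. proper_connecting_coloring F c"
proof -
  interpret F: pair_graph F by fact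
  have "finite (edges F)"
    by (simp add: edges_def F.pair_finite_arcs)
  then obtain c :: "'a set \<Rightarrow> nat" where c: "inj_on c (edges F)"
    using finite_imp_inj_to_nat_seg by metis
  have "proper_connecting_coloring F c"
    unfolding proper_connecting_coloring_def
  proof (intro ballI impI)
    fix x y assume "x \<in> pverts F" "y \<in> pverts F"
    moreover have "mk_symmetric (with_proj F) = F"
      using F.graph_symmetric by (auto simp: mk_symmetric_def intro!: pair_pre_digraph.equality)
    ultimately have "reachable (with_proj F) x y"
      using assms(2) by (auto simp: connected_def strongly_connected_def)
    then obtain p where p: "F.apath x p y"
      using F.reachable_apath by blast
    have arcs: "set p \<subseteq> parcs F"
      using p by (auto simp: F.apath_def F.awalk_def)
    have "edge (p ! i) \<noteq> edge (p ! j)" if "i < j" "j < length p" for i j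
    proof
      assume eq: "edge (p ! i) = edge (p ! j)"
      have vs: "pawalk_verts x p = map fst p @ [snd (last p)]" and dist: "distinct (pawalk_verts x p)"
        using p that F.awalk_verts_conv[of x p] by (auto simp: F.apath_def)
      have vs': "pawalk_verts x p = fst (hd p) # map snd p"
        using p that F.awalk_verts_conv'[of x p y] by (auto simp: F.apath_def F.awalk_def)
      have "distinct (map fst p)" "distinct (map snd p)"
        using dist by (simp add: vs, simp add: vs')
      then have ne: "fst (p ! i) \<noteq> fst (p ! j)" "snd (p ! i) \<noteq> snd (p ! j)"
        using that by (auto simp: distinct_conv_nth)
      have "pawalk_verts x p ! i = fst (p ! i)"
        using that by (simp add: vs nth_append)
      moreover have "pawalk_verts x p ! Suc j = snd (p ! j)"
        using that by (simp add: vs')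
      moreover have "length (pawalk_verts x p) = Suc (length p)"
        by (simp add: vs)
      ultimately have "fst (p ! i) \<noteq> snd (p ! j)"
        using nth_eq_iff_index_eq[OF dist, of i "Suc j"] that by simp
      then show False
        using eq ne by (auto simp: edge_def doubleton_eq_iff)
    qed
    moreover have "edge (p ! i) \<in> edges F" if "i < length p" for i
      using subsetD[OF arcs nth_mem[OF that]] by (simp add: edges_def)
    ultimately have "c (edge (p ! i)) \<noteq> c (edge (p ! j))" if "i < j" "j < length p" for i j
      using that inj_onD[OF c, of "edge (p ! i)" "edge (p ! j)"] by auto
    then have "distance2_proper_path F c x p y"
      using p unfolding distance2_proper_path_def by blast
    then show "\<exists>p. distance2_proper_path F c x p y" ..
  qed
  then show ?thesis by blast
qed

definition condition_E :: "'a pair_pre_digraph \<Rightarrow> 'b pair_pre_digraph \<Rightarrow> bool" where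
  "condition_E G H \<longleftrightarrow>
     star_graph G \<and> (\<forall>T. undirected_spanning_tree T H \<longrightarrow> radius T \<ge> 3) \<or>
     star_graph H \<and> (\<forall>T. undirected_spanning_tree T G \<longrightarrow> radius T \<ge> 3)"

end

(*
  Root a spanning tree in each factor, at r1 and r2. A vertex (u, v) of the product can climb to
  (r1, r2) inside layer v and then inside column r1, and (r1, r2) can descend to (x, z) inside
  layer r2 and then inside column x. A coloring by residues modulo 3 of signed sums of levels makes
  the colors along such a route follow the cycle 0, 1, 2. This joins all pairs of vertices except
  those in layer r2 or in column r1, for which the route is preceded by a descent to a level (or
  followed by a climb from a level) complementary modulo 3. All the levels needed exist if both
  trees have a vertex on level 3, or if both have height 2. A connected graph without a path on
  four vertices is a star or a triangle. A triangle is handled by means of its third edge, and the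
  product of K2 with a tree of height 2 by recoloring the leaves on level 1. In the remaining case,
  a star times a graph whose spanning trees all have radius at least 3, a fourth color on the edges
  entering column r1 lets a route return to that column from any layer.
*)
theory Submission
  imports Defs
begin

text \<open>In three colors a distance 2-proper path must repeat its colors with period 3, since any
  three consecutive edges use all of them. So a path carries nothing but a phase modulo 3, and two
  pieces fit together when their phases agree at the joint. Let \<open>s\<close> be the sum of the
  two levels of \<open>(u, v)\<close>. A climb from \<open>(u, v)\<close> starts in phase
  \<open>1 - s\<close>, a descent to it ends in phase \<open>1 + s\<close>; hence a descent can be
  continued by a climb exactly when 3 divides \<open>s\<close>. This is the origin of the
  complementary levels. The obstacle is the residue 0. A vertex on level 3 of one tree needs a
  partner on a level divisible by 3, other than the root, in the other tree, and a factor without a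
  path on four vertices has no such level. So both trees should reach level 3 or both should stop at
  level 2; the second option is what a spanning tree of radius at most 2 provides. An edge of color
  3 fits any phase, but a second one nearby could clash with it; this is why at most one is allowed
  on a path.\<close>

section \<open>Paths whose colors run cyclically modulo 3\<close>

text \<open>
  \<open>cyclic_path E \<kappa> p x S n q y\<close>: some path from \<open>x\<close> to \<open>y\<close> has vertex set \<open>S\<close>, and its successive
  colors are \<open>p, p + 1, ..., q - 1\<close> modulo \<open>3\<close>, except that \<open>n\<close> of its edges have the color \<open>3\<close> instead.
\<close>

inductive cyclic_path :: "('v \<Rightarrow> 'v \<Rightarrow> bool) \<Rightarrow> ('v \<Rightarrow> 'v \<Rightarrow> int) \<Rightarrow> int \<Rightarrow> 'v \<Rightarrow> 'v set \<Rightarrow> nat \<Rightarrow> int \<Rightarrow> 'v \<Rightarrow> bool"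
  for E :: "'v \<Rightarrow> 'v \<Rightarrow> bool" and \<kappa> :: "'v \<Rightarrow> 'v \<Rightarrow> int" where
  refl: "p mod 3 = q mod 3 \<Longrightarrow> cyclic_path E \<kappa> p x {x} 0 q x"
| step: "\<lbrakk>E x y; \<kappa> x y = p mod 3; x \<notin> S; cyclic_path E \<kappa> (p + 1) y S n q z\<rbrakk> \<Longrightarrow> cyclic_path E \<kappa> p x (insert x S) n q z"
| wild: "\<lbrakk>E x y; \<kappa> x y = 3; x \<notin> S; cyclic_path E \<kappa> (p + 1) y S n q z\<rbrakk> \<Longrightarrow> cyclic_path E \<kappa> p x (insert x S) (Suc n) q z"

lemma cyclic_path_start: "cyclic_path E \<kappa> p x S n q y \<Longrightarrow> x \<in> S"
  by (induction rule: cyclic_path.induct) auto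

lemma cyclic_path_end: "cyclic_path E \<kappa> p x S n q y \<Longrightarrow> y \<in> S"
  by (induction rule: cyclic_path.induct) auto

lemma cyclic_path_cong:
  assumes "cyclic_path E \<kappa> p x S n q y" "p mod 3 = p' mod 3" "q mod 3 = q' mod 3"
  shows "cyclic_path E \<kappa> p' x S n q' y"
  using assms
proof (induction arbitrary: p' q' rule: cyclic_path.induct)
  case (refl p q x)
  then show ?case by (intro cyclic_path.refl) simp
next
  case (step x y p S n q z)
  then have "(p + 1) mod 3 = (p' + 1) mod 3" by (metis mod_add_cong)
  then have "cyclic_path E \<kappa> (p' + 1) y S n q' z" using step by blast
  moreover have "\<kappa> x y = p' mod 3" using step by metis
  ultimately show ?case using cyclic_path.step step.hyps by metis
next
  case (wild x y S p n q z)
  then have "(p + 1) mod 3 = (p' + 1) mod 3" by (metis mod_add_cong)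
  then have "cyclic_path E \<kappa> (p' + 1) y S n q' z" using wild by blast
  then show ?case using cyclic_path.wild wild.hyps by metis
qed

text \<open>This is why vertex sets and phases are carried along: a joint needs only a common phase
  \<open>q\<close> and no common vertex besides \<open>y\<close>.\<close>

lemma cyclic_path_append:
  assumes "cyclic_path E \<kappa> p x S m q y" "cyclic_path E \<kappa> q y T n s z" "S \<inter> T \<subseteq> {y}"
  shows "cyclic_path E \<kappa> p x (S \<union> T) (m + n) s z"
  using assms
proof (induction rule: cyclic_path.induct)
  case (refl p q x)
  then have "cyclic_path E \<kappa> p x T n s z" by (auto intro: cyclic_path_cong)
  moreover have "{x} \<union> T = T" using refl cyclic_path_start by fast
  ultimately show ?case by simp
next
  case (step x y' p S m q y)
  have "y \<in> S" using step.hyps cyclic_path_end by fast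
  then have "x \<notin> T" using step by auto
  then show ?case using step by (auto intro: cyclic_path.step[of E x y'])
next
  case (wild x y' S p m q y)
  have "y \<in> S" using wild.hyps cyclic_path_end by fast
  then have "x \<notin> T" using wild by auto
  then show ?case using wild by (auto intro: cyclic_path.wild[of E x y'])
qed

lemma cyclic_path_snoc:
  assumes "cyclic_path E \<kappa> p x S n q y" "E y z" "\<kappa> y z = q mod 3" "z \<notin> S"
  shows "cyclic_path E \<kappa> p x (insert z S) n (q + 1) z"
proof -
  have "y \<noteq> z" using assms cyclic_path_end by fast
  have "cyclic_path E \<kappa> q y {y, z} 0 (q + 1) z"
    using assms \<open>y \<noteq> z\<close> by (auto intro!: cyclic_path.step[of E y z] cyclic_path.refl)
  then show ?thesis
    using cyclic_path_append[OF assms(1), of "{y,z}" 0 "q + 1" z] assms cyclic_path_end[OF assms(1)]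
    by (simp add: insert_absorb insert_commute)
qed

lemma cyclic_path_snoc_wild:
  assumes "cyclic_path E \<kappa> p x S n q y" "E y z" "\<kappa> y z = 3" "z \<notin> S"
  shows "cyclic_path E \<kappa> p x (insert z S) (Suc n) (q + 1) z"
proof -
  have "y \<noteq> z" using assms cyclic_path_end by fast
  have "cyclic_path E \<kappa> q y {y, z} 1 (q + 1) z"
    using assms \<open>y \<noteq> z\<close> by (auto intro!: cyclic_path.wild[of E y z] cyclic_path.refl)
  then show ?thesis
    using cyclic_path_append[OF assms(1), of "{y,z}" 1 "q + 1" z] assms cyclic_path_end[OF assms(1)]
    by (simp add: insert_absorb insert_commute)
qed

lemma cyclic_path_map:
  assumes "cyclic_path E \<kappa> p x S n q y" "inj f"
    and "\<And>u v. E u v \<Longrightarrow> E' (f u) (f v)" "\<And>u v. \<kappa>' (f u) (f v) = \<kappa> u v"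
  shows "cyclic_path E' \<kappa>' p (f x) (f ` S) n q (f y)"
  using assms(1)
proof (induction rule: cyclic_path.induct)
  case (step x y p S n q z)
  then have "f x \<notin> f ` S" using assms(2) by (auto dest: injD)
  then show ?case using step assms by (auto intro: cyclic_path.step[of E' "f x" "f y"])
next
  case (wild x y S p n q z)
  then have "f x \<notin> f ` S" using assms(2) by (auto dest: injD)
  then show ?case using wild assms by (auto intro: cyclic_path.wild[of E' "f x" "f y"])
qed (auto intro: cyclic_path.refl)

text \<open>Read backwards, the colors decrease cyclically, which is equally good for a distance
  2-proper path; so either direction may serve.\<close>

definition linked :: "('v \<Rightarrow> 'v \<Rightarrow> bool) \<Rightarrow> ('v \<Rightarrow> 'v \<Rightarrow> int) \<Rightarrow> 'v \<Rightarrow> 'v \<Rightarrow> bool" where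
  "linked E \<kappa> x y \<longleftrightarrow> (\<exists>p S n q. cyclic_path E \<kappa> p x S n q y \<and> n \<le> 1) \<or> (\<exists>p S n q. cyclic_path E \<kappa> p y S n q x \<and> n \<le> 1)"

lemma linkedI: "cyclic_path E \<kappa> p x S n q y \<Longrightarrow> n \<le> 1 \<Longrightarrow> linked E \<kappa> x y"
  unfolding linked_def by blast

lemma linked_sym: "linked E \<kappa> x y \<longleftrightarrow> linked E \<kappa> y x"
  unfolding linked_def by blast

lemma linked_map:
  assumes "linked E \<kappa> x y" "inj f"
    and "\<And>u v. E u v \<Longrightarrow> E' (f u) (f v)" "\<And>u v. \<kappa>' (f u) (f v) = \<kappa> u v"
  shows "linked E' \<kappa>' (f x) (f y)"
  using assms(1) cyclic_path_map[OF _ assms(2), of E \<kappa> _ _ _ _ _ _ E' \<kappa>'] assms(3,4) unfolding linked_def by meson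

text \<open>A form that simplification can decide for an explicit list of vertices, for the finite
  checks in the product with K2.\<close>

fun cyclic_run :: "('v \<Rightarrow> 'v \<Rightarrow> bool) \<Rightarrow> ('v \<Rightarrow> 'v \<Rightarrow> int) \<Rightarrow> int \<Rightarrow> 'v list \<Rightarrow> bool" where
  "cyclic_run E \<kappa> p (x # y # zs) \<longleftrightarrow> E x y \<and> \<kappa> x y = p mod 3 \<and> cyclic_run E \<kappa> (p + 1) (y # zs)"
| "cyclic_run E \<kappa> p _ \<longleftrightarrow> True"

lemma cyclic_path_of_cyclic_run:
  "vs \<noteq> [] \<Longrightarrow> distinct vs \<Longrightarrow> cyclic_run E \<kappa> p vs \<Longrightarrow> cyclic_path E \<kappa> p (hd vs) (set vs) 0 (p + length vs - 1) (last vs)"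
proof (induction E \<kappa> p vs rule: cyclic_run.induct)
  case (1 E \<kappa> p x y zs)
  then have "cyclic_path E \<kappa> (p + 1) y (set (y # zs)) 0 (p + length (x # y # zs) - 1) (last (y # zs))"
    by (simp add: algebra_simps)
  then show ?case using 1 cyclic_path.step[of E x y \<kappa> p "set (y # zs)"] by simp
qed (auto intro: cyclic_path.refl)

lemma linked_of_cyclic_run:
  assumes "vs \<noteq> []" "distinct vs" "cyclic_run E \<kappa> p vs"
  shows "linked E \<kappa> (hd vs) (last vs)"
  using cyclic_path_of_cyclic_run[OF assms] by (rule linkedI) simp

section \<open>Rooted trees given by parents and levels\<close>

locale rooted_tree =
  fixes V :: "'a set" and r :: 'a and par :: "'a \<Rightarrow> 'a" and lev :: "'a \<Rightarrow> nat"
  assumes root_in: "r \<in> V" and lev_root: "lev r = 0"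
    and par_in: "v \<in> V \<Longrightarrow> v \<noteq> r \<Longrightarrow> par v \<in> V"
    and lev_par: "v \<in> V \<Longrightarrow> v \<noteq> r \<Longrightarrow> lev v = Suc (lev (par v))"
begin

lemma lev_eq_0_iff: "v \<in> V \<Longrightarrow> lev v = 0 \<longleftrightarrow> v = r"
  using lev_root lev_par by fastforce

text \<open>The vertices of the tree path from \<open>v\<close> to the root, both ends included.
  Stopping after \<open>lev v\<close> steps keeps out \<open>par r\<close>, about which nothing is
  assumed.\<close>

definition anc :: "'a \<Rightarrow> 'a set" where
  "anc v = (\<lambda>i. (par ^^ i) v) ` {..lev v}"

lemma anc_root: "anc r = {r}"
  by (simp add: anc_def lev_root)

lemma anc_rec: "v \<in> V \<Longrightarrow> v \<noteq> r \<Longrightarrow> anc v = insert v (anc (par v))"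
  unfolding anc_def using lev_par[of v]
  by (simp add: atMost_Suc_eq_insert_0 image_image funpow_swap1)

lemma tree_induct [consumes 1, case_names root child]:
  assumes "v \<in> V" "P r" "\<And>v. v \<in> V \<Longrightarrow> v \<noteq> r \<Longrightarrow> P (par v) \<Longrightarrow> P v"
  shows "P v"
  using assms(1)
proof (induction "lev v" arbitrary: v rule: less_induct)
  case less
  show ?case
  proof (cases "v = r")
    case False
    have "P (par v)" using less lev_par[of v] par_in[of v] False by simp
    then show ?thesis using assms(3) less False by blast
  qed (use assms in simp)
qed

lemma self_in_anc: "v \<in> anc v"
  unfolding anc_def by (rule image_eqI[of _ _ 0]) auto

lemma lev_anc: "v \<in> V \<Longrightarrow> x \<in> anc v \<Longrightarrow> x \<noteq> v \<Longrightarrow> lev x < lev v"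
proof (induction rule: tree_induct)
  case (child v)
  then show ?case using lev_par[of v] by (cases "x = par v") (auto simp: anc_rec)
qed (auto simp: anc_root)

lemma anc_antisym: "u \<in> V \<Longrightarrow> v \<in> V \<Longrightarrow> u \<in> anc v \<Longrightarrow> v \<in> anc u \<Longrightarrow> u = v"
  using lev_anc by (metis less_asym)

lemma not_in_anc_par: "v \<in> V \<Longrightarrow> v \<noteq> r \<Longrightarrow> v \<notin> anc (par v)"
  using lev_anc[of "par v" v] par_in[of v] lev_par[of v] by fastforce

lemma par_in_anc: "v \<in> V \<Longrightarrow> x \<in> anc v \<Longrightarrow> x \<noteq> r \<Longrightarrow> par x \<in> anc v"
  by (induction rule: tree_induct) (auto simp: anc_root anc_rec self_in_anc)

end

section \<open>Routes in the product of two rooted trees\<close>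

text \<open>
  A vertex \<open>(u, v)\<close> climbs to \<open>(r1, r2)\<close> by first using the edges of the first tree in layer
  \<open>v\<close> and then those of the second tree in column \<open>r1\<close>; it is reached from \<open>(r1, r2)\<close> by
  descending first in layer \<open>r2\<close> and then in column \<open>u\<close>. The colors are chosen so that
  they run cyclically through \<open>0, 1, 2\<close> along a climb followed by a descent. If \<open>w\<close> holds, the edges
  entering column \<open>r1\<close> outside layer \<open>r2\<close> have the extra color \<open>3\<close> instead.
\<close>

locale tree_product =
  T1: rooted_tree V1 r1 p1 l1 + T2: rooted_tree V2 r2 p2 l2
  for V1 :: "'a set" and r1 p1 l1 and V2 :: "'b set" and r2 p2 l2 +
  fixes E :: "'a \<times> 'b \<Rightarrow> 'a \<times> 'b \<Rightarrow> bool" and \<kappa> :: "'a \<times> 'b \<Rightarrow> 'a \<times> 'b \<Rightarrow> int" and w :: bool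
  assumes E_sym: "E x y \<Longrightarrow> E y x" and \<kappa>_sym: "\<kappa> x y = \<kappa> y x"
    and E1: "\<lbrakk>u \<in> V1; u \<noteq> r1; v \<in> V2\<rbrakk> \<Longrightarrow> E (u, v) (p1 u, v)"
    and E2: "\<lbrakk>u \<in> V1; v \<in> V2; v \<noteq> r2\<rbrakk> \<Longrightarrow> E (u, v) (u, p2 v)"
    and \<kappa>1_root: "\<lbrakk>u \<in> V1; u \<noteq> r1\<rbrakk> \<Longrightarrow> \<kappa> (u, r2) (p1 u, r2) = int (l1 u) mod 3"
    and \<kappa>1_wild: "\<lbrakk>u \<in> V1; l1 u = 1; v \<in> V2; v \<noteq> r2; w\<rbrakk> \<Longrightarrow> \<kappa> (u, v) (p1 u, v) = 3"
    and \<kappa>1: "\<lbrakk>u \<in> V1; u \<noteq> r1; v \<in> V2; v \<noteq> r2; \<not> (w \<and> l1 u = 1)\<rbrakk> \<Longrightarrow> \<kappa> (u, v) (p1 u, v) = (1 - int (l1 u) - int (l2 v)) mod 3"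
    and \<kappa>2_root: "\<lbrakk>v \<in> V2; v \<noteq> r2\<rbrakk> \<Longrightarrow> \<kappa> (r1, v) (r1, p2 v) = (1 - int (l2 v)) mod 3"
    and \<kappa>2: "\<lbrakk>u \<in> V1; u \<noteq> r1; v \<in> V2; v \<noteq> r2\<rbrakk> \<Longrightarrow> \<kappa> (u, v) (u, p2 v) = (int (l1 u) + int (l2 v)) mod 3"
begin

definition wilds :: "'a \<Rightarrow> nat" where
  "wilds u = (if w \<and> u \<noteq> r1 then 1 else 0)"

lemma wilds_le: "wilds u \<le> 1"
  by (simp add: wilds_def)

text \<open>Passing to the parent lowers \<open>l1 u\<close> by one and so raises the phase by one.
  Layer \<open>r2\<close> is excluded because its edges are colored for descending.\<close>

lemma climb1:
  assumes "u \<in> V1" "v \<in> V2" "v \<noteq> r2"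
  shows "cyclic_path E \<kappa> (1 - int (l1 u) - int (l2 v)) (u, v) (T1.anc u \<times> {v}) (wilds u) (1 - int (l2 v)) (r1, v)"
  using assms(1)
proof (induction rule: T1.tree_induct)
  case root
  then show ?case by (auto simp: T1.anc_root T1.lev_root wilds_def intro: cyclic_path.refl)
next
  case (child u)
  have S: "T1.anc u \<times> {v} = insert (u, v) (T1.anc (p1 u) \<times> {v})"
    using T1.anc_rec child by auto
  have lu: "l1 u = Suc (l1 (p1 u))" using T1.lev_par child by simp
  have IH: "cyclic_path E \<kappa> (1 - int (l1 u) - int (l2 v) + 1) (p1 u, v) (T1.anc (p1 u) \<times> {v}) (wilds (p1 u)) (1 - int (l2 v)) (r1, v)"
    using child.IH lu by (simp add: algebra_simps)
  have n: "(u, v) \<notin> T1.anc (p1 u) \<times> {v}" using T1.not_in_anc_par child by simp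
  have pu: "p1 u = r1 \<longleftrightarrow> l1 u = 1" using T1.lev_eq_0_iff[OF T1.par_in] child lu by simp
  show ?case
  proof (cases "w \<and> l1 u = 1")
    case True
    then have "wilds u = Suc (wilds (p1 u))" using child pu unfolding wilds_def by simp
    then show ?thesis unfolding S
      using cyclic_path.wild[OF E1 \<kappa>1_wild n IH] child True assms by simp
  next
    case False
    then have "wilds u = wilds (p1 u)" using child pu unfolding wilds_def by simp
    then show ?thesis unfolding S
      using cyclic_path.step[OF E1 \<kappa>1 n IH] child False assms by simp
  qed
qed

lemma climb2:
  assumes "v \<in> V2"
  shows "cyclic_path E \<kappa> (1 - int (l2 v)) (r1, v) ({r1} \<times> T2.anc v) 0 1 (r1, r2)"
  using assms
proof (induction rule: T2.tree_induct)
  case root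
  then show ?case by (auto simp: T2.anc_root T2.lev_root intro: cyclic_path.refl)
next
  case (child v)
  have S: "{r1} \<times> T2.anc v = insert (r1, v) ({r1} \<times> T2.anc (p2 v))"
    using T2.anc_rec child by auto
  have IH: "cyclic_path E \<kappa> (1 - int (l2 v) + 1) (r1, p2 v) ({r1} \<times> T2.anc (p2 v)) 0 1 (r1, r2)"
    using child.IH T2.lev_par child by simp
  have n: "(r1, v) \<notin> {r1} \<times> T2.anc (p2 v)" using T2.not_in_anc_par child by simp
  show ?case unfolding S
    using cyclic_path.step[OF E2 \<kappa>2_root n IH] child T1.root_in by simp
qed

lemma descend1:
  assumes "u \<in> V1"
  shows "cyclic_path E \<kappa> 1 (r1, r2) (T1.anc u \<times> {r2}) 0 (1 + int (l1 u)) (u, r2)"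
  using assms
proof (induction rule: T1.tree_induct)
  case root
  then show ?case by (auto simp: T1.anc_root T1.lev_root intro: cyclic_path.refl)
next
  case (child u)
  have S: "T1.anc u \<times> {r2} = insert (u, r2) (T1.anc (p1 u) \<times> {r2})"
    using T1.anc_rec child by auto
  have lu: "l1 u = Suc (l1 (p1 u))" using T1.lev_par child by simp
  have n: "(u, r2) \<notin> T1.anc (p1 u) \<times> {r2}" using T1.not_in_anc_par child by simp
  have "E (p1 u, r2) (u, r2)" using E_sym E1 child T2.root_in by simp
  moreover have "\<kappa> (p1 u, r2) (u, r2) = (1 + int (l1 (p1 u))) mod 3"
    using \<kappa>1_root child lu by (simp add: \<kappa>_sym[of "(p1 u, r2)"])
  ultimately have "cyclic_path E \<kappa> 1 (r1, r2) (insert (u, r2) (T1.anc (p1 u) \<times> {r2})) 0 (1 + int (l1 (p1 u)) + 1) (u, r2)"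
    using cyclic_path_snoc[OF child.IH _ _ n] by blast
  then show ?case unfolding S using lu by simp
qed

lemma descend2:
  assumes "u \<in> V1" "u \<noteq> r1" "v \<in> V2"
  shows "cyclic_path E \<kappa> (1 + int (l1 u)) (u, r2) ({u} \<times> T2.anc v) 0 (1 + int (l1 u) + int (l2 v)) (u, v)"
  using assms(3)
proof (induction rule: T2.tree_induct)
  case root
  then show ?case by (auto simp: T2.anc_root T2.lev_root intro: cyclic_path.refl)
next
  case (child v)
  have S: "{u} \<times> T2.anc v = insert (u, v) ({u} \<times> T2.anc (p2 v))"
    using T2.anc_rec child by auto
  have lv: "l2 v = Suc (l2 (p2 v))" using T2.lev_par child by simp
  have n: "(u, v) \<notin> {u} \<times> T2.anc (p2 v)" using T2.not_in_anc_par child by simp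
  have "E (u, p2 v) (u, v)" using E_sym E2 child assms by simp
  moreover have "\<kappa> (u, p2 v) (u, v) = (1 + int (l1 u) + int (l2 (p2 v))) mod 3"
    using \<kappa>2 child lv assms by (simp add: \<kappa>_sym[of "(u, p2 v)"] algebra_simps)
  ultimately have "cyclic_path E \<kappa> (1 + int (l1 u)) (u, r2) (insert (u, v) ({u} \<times> T2.anc (p2 v))) 0 (1 + int (l1 u) + int (l2 (p2 v)) + 1) (u, v)"
    using cyclic_path_snoc[OF child.IH _ _ n] by blast
  then show ?case unfolding S using lv by (simp add: algebra_simps)
qed

definition route :: "'a \<Rightarrow> 'b \<Rightarrow> 'a \<Rightarrow> 'b \<Rightarrow> ('a \<times> 'b) set" where
  "route u v x z = T1.anc u \<times> {v} \<union> {r1} \<times> T2.anc v \<union> T1.anc x \<times> {r2} \<union> {x} \<times> T2.anc z"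

text \<open>Layer \<open>r2\<close> is colored for descending and column \<open>r1\<close> for
  climbing, so no climb may start in layer \<open>r2\<close> away from the root and no descent may
  end in column \<open>r1\<close> away from it. The first and the last segment could still meet,
  namely in \<open>(x, v)\<close>, which the last hypothesis rules out.\<close>

lemma route_path:
  assumes "u \<in> V1" "v \<in> V2" "x \<in> V1" "z \<in> V2"
    and "v = r2 \<Longrightarrow> u = r1" "x = r1 \<Longrightarrow> z = r2" "x \<in> T1.anc u \<Longrightarrow> v \<notin> T2.anc z"
  shows "cyclic_path E \<kappa> (1 - int (l1 u) - int (l2 v)) (u, v) (route u v x z) (wilds u) (1 + int (l1 x) + int (l2 z)) (x, z)"
proof -
  have up: "cyclic_path E \<kappa> (1 - int (l1 u) - int (l2 v)) (u, v) (T1.anc u \<times> {v}) (wilds u) (1 - int (l2 v)) (r1, v)"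
  proof (cases "v = r2")
    case True
    then show ?thesis using assms(5)
      by (auto simp: T1.anc_root T1.lev_root wilds_def intro: cyclic_path.refl)
  qed (use climb1 assms in blast)
  have down: "cyclic_path E \<kappa> (1 + int (l1 x)) (x, r2) ({x} \<times> T2.anc z) 0 (1 + int (l1 x) + int (l2 z)) (x, z)"
  proof (cases "x = r1")
    case True
    then show ?thesis using assms(6)
      by (auto simp: T2.anc_root T1.lev_root T2.lev_root intro: cyclic_path.refl)
  qed (use descend2 assms in blast)
  have "cyclic_path E \<kappa> (1 - int (l1 u) - int (l2 v)) (u, v) (T1.anc u \<times> {v} \<union> {r1} \<times> T2.anc v) (wilds u + 0) 1 (r1, r2)"
    by (rule cyclic_path_append[OF up climb2[OF assms(2)]]) auto
  then have "cyclic_path E \<kappa> (1 - int (l1 u) - int (l2 v)) (u, v)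
      (T1.anc u \<times> {v} \<union> {r1} \<times> T2.anc v \<union> T1.anc x \<times> {r2}) (wilds u + 0 + 0) (1 + int (l1 x)) (x, r2)"
    by (rule cyclic_path_append[OF _ descend1[OF assms(3)]]) (use assms(5) in \<open>auto simp: T1.anc_root\<close>)
  then have "cyclic_path E \<kappa> (1 - int (l1 u) - int (l2 v)) (u, v)
      (T1.anc u \<times> {v} \<union> {r1} \<times> T2.anc v \<union> T1.anc x \<times> {r2} \<union> {x} \<times> T2.anc z)
      (wilds u + 0 + 0 + 0) (1 + int (l1 x) + int (l2 z)) (x, z)"
    by (rule cyclic_path_append[OF _ down]) (use assms(6,7) in \<open>auto simp: T2.anc_root\<close>)
  then show ?thesis by (simp add: route_def)
qed

lemma route_linked:
  assumes "u \<in> V1" "v \<in> V2" "x \<in> V1" "z \<in> V2"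
    and "v = r2 \<Longrightarrow> u = r1" "x = r1 \<Longrightarrow> z = r2" "x \<in> T1.anc u \<Longrightarrow> v \<notin> T2.anc z"
  shows "linked E \<kappa> (u, v) (x, z)"
  using route_path[OF assms] wilds_le by (rule linkedI)

text \<open>A descent in column \<open>u\<close> first leaves layer \<open>r2\<close>, and the usual
  route then starts from \<open>(u, t)\<close>. That \<open>u\<close> is no ancestor of
  \<open>x\<close> keeps the final descent in layer \<open>r2\<close> off the starting
  vertex.\<close>

lemma row_linked_aux:
  assumes "u \<in> V1" "x \<in> V1" "u \<noteq> r1" "x \<noteq> r1" "u \<notin> T1.anc x"
    and "t \<in> V2" "t \<noteq> r2" "3 dvd l1 u + l2 t"
  shows "linked E \<kappa> (u, r2) (x, r2)"
proof -
  have d: "cyclic_path E \<kappa> (1 + int (l1 u)) (u, r2) ({u} \<times> T2.anc t) 0 (1 - int (l1 u) - int (l2 t)) (u, t)"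
  proof (rule cyclic_path_cong[OF descend2])
    \<comment> \<open>Both phases are 1 modulo 3, because the level sum is divisible by 3.\<close>
    show "(1 + int (l1 u) + int (l2 t)) mod 3 = (1 - int (l1 u) - int (l2 t)) mod 3"
      using assms(8) by presburger
  qed (use assms in auto)
  have m: "cyclic_path E \<kappa> (1 - int (l1 u) - int (l2 t)) (u, t) (route u t x r2) (wilds u) (1 + int (l1 x) + int (l2 r2)) (x, r2)"
    using assms T2.root_in by (intro route_path) (auto simp: T2.anc_root)
  have "{u} \<times> T2.anc t \<inter> route u t x r2 \<subseteq> {(u, t)}"
    using assms T2.anc_root T1.self_in_anc by (fastforce simp: route_def)
  from linkedI[OF cyclic_path_append[OF d m this]] show ?thesis
    using wilds_le[of u] by simp
qed

lemma row_linked: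
  assumes "u \<in> V1" "x \<in> V1" "u \<noteq> r1" "x \<noteq> r1" "u \<noteq> x"
    and "\<And>u. u \<in> V1 \<Longrightarrow> u \<noteq> r1 \<Longrightarrow> \<exists>t\<in>V2. t \<noteq> r2 \<and> 3 dvd l1 u + l2 t"
  shows "linked E \<kappa> (u, r2) (x, r2)"
proof (cases "u \<in> T1.anc x")
  case False
  then show ?thesis using row_linked_aux assms by blast
next
  case True
  then have "x \<notin> T1.anc u" using assms T1.anc_antisym by blast
  then show ?thesis using row_linked_aux[of x u] assms linked_sym[of E \<kappa>] by blast
qed

lemma column_descent:
  assumes "v \<in> V2" "z \<in> V2" "v \<noteq> r2" "z \<noteq> r2" "z \<notin> T2.anc v" "t \<in> V1" "t \<noteq> r1"
  shows "cyclic_path E \<kappa> (1 - int (l2 v)) (r1, v) (route r1 v t z) 0 (1 + int (l1 t) + int (l2 z)) (t, z)"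
  using route_path[of r1 v t z] assms T1.root_in by (auto simp: T1.anc_root T1.lev_root wilds_def)

text \<open>Mirror image of the row case: the extra piece is a climb at the end, from
  \<open>(t, z)\<close>. That \<open>z\<close> is no ancestor of \<open>v\<close> keeps
  \<open>(r1, z)\<close> off the initial climb in column \<open>r1\<close>.\<close>

lemma column_path:
  assumes "v \<in> V2" "z \<in> V2" "v \<noteq> r2" "z \<noteq> r2" "z \<notin> T2.anc v"
    and "t \<in> V1" "t \<noteq> r1" "3 dvd l1 t + l2 z"
  shows "cyclic_path E \<kappa> (1 - int (l2 v)) (r1, v) (route r1 v t z \<union> T1.anc t \<times> {z}) (wilds t) (1 - int (l2 z)) (r1, z)"
proof -
  have "cyclic_path E \<kappa> (1 + int (l1 t) + int (l2 z)) (t, z) (T1.anc t \<times> {z}) (wilds t) (1 - int (l2 z)) (r1, z)"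
  proof (rule cyclic_path_cong[OF climb1])
    show "(1 - int (l1 t) - int (l2 z)) mod 3 = (1 + int (l1 t) + int (l2 z)) mod 3"
      using assms(8) by presburger
  qed (use assms in auto)
  moreover have "route r1 v t z \<inter> T1.anc t \<times> {z} \<subseteq> {(t, z)}"
    using assms T2.self_in_anc T1.anc_root by (auto simp: route_def)
  ultimately show ?thesis
    using cyclic_path_append[OF column_descent[OF assms(1-7)], of "T1.anc t \<times> {z}" "wilds t"] by simp
qed

lemma column_linked:
  assumes "v \<in> V2" "z \<in> V2" "v \<noteq> r2" "z \<noteq> r2" "z \<notin> T2.anc v"
    and "t \<in> V1" "t \<noteq> r1" "3 dvd l1 t + l2 z"
  shows "linked E \<kappa> (r1, v) (r1, z)"
  using column_path[OF assms] wilds_le by (rule linkedI)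

text \<open>A route that starts in column \<open>r1\<close> has no edge of color 3 yet, so the
  closing edge may be the one allowed, and no congruence between levels is needed.\<close>

lemma column_linked_wild:
  assumes "v \<in> V2" "z \<in> V2" "v \<noteq> r2" "z \<noteq> r2" "z \<notin> T2.anc v"
    and "t \<in> V1" "l1 t = 1" w
  shows "linked E \<kappa> (r1, v) (r1, z)"
proof -
  have t: "t \<noteq> r1" using assms T1.lev_root by auto
  then have "p1 t = r1" using T1.lev_eq_0_iff[OF T1.par_in] T1.lev_par[of t] assms by simp
  then have "E (t, z) (r1, z)" "\<kappa> (t, z) (r1, z) = 3"
    using E1[of t z] \<kappa>1_wild[of t z] assms t by auto
  moreover have "(r1, z) \<notin> route r1 v t z"
    using assms t T1.anc_root T2.self_in_anc by (fastforce simp: route_def)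
  ultimately show ?thesis
    using linkedI[OF cyclic_path_snoc_wild[OF column_descent[OF assms(1-6) t]]] by simp
qed

text \<open>Here the closing edge may lie outside the tree; it will be the third edge of a
  triangle.\<close>

lemma column_linked_edge:
  assumes "v \<in> V2" "z \<in> V2" "v \<noteq> r2" "z \<noteq> r2" "z \<notin> T2.anc v"
    and "t \<in> V1" "t \<noteq> r1" "E (t, z) (r1, z)" "\<kappa> (t, z) (r1, z) = (1 + int (l1 t) + int (l2 z)) mod 3"
  shows "linked E \<kappa> (r1, v) (r1, z)"
proof -
  have "(r1, z) \<notin> route r1 v t z"
    using assms T1.anc_root T2.self_in_anc by (fastforce simp: route_def)
  then show ?thesis
    using linkedI[OF cyclic_path_snoc[OF column_descent[OF assms(1-7)] assms(8,9)]] by simp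
qed

text \<open>For a target \<open>p2 k\<close> whose own level has no complement: the path returns to
  column \<open>r1\<close> one level lower in the tree, at \<open>k\<close>, and makes the last step
  up in that column.\<close>

lemma column_linked_via:
  assumes "v \<in> V2" "v \<noteq> r2" "k \<in> V2" "k \<noteq> r2" "p2 k \<noteq> r2" "p2 k \<notin> T2.anc v"
    and "t \<in> V1" "t \<noteq> r1" "3 dvd l1 t + l2 k"
  shows "linked E \<kappa> (r1, v) (r1, p2 k)"
proof -
  have "k \<notin> T2.anc v" using assms T2.par_in_anc by blast
  then have s: "cyclic_path E \<kappa> (1 - int (l2 v)) (r1, v) (route r1 v t k \<union> T1.anc t \<times> {k}) (wilds t) (1 - int (l2 k)) (r1, k)"
    using column_path assms by blast
  have "p2 k \<noteq> k" using T2.lev_par[of k] assms by (metis n_not_Suc_n)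
  then have "(r1, p2 k) \<notin> route r1 v t k \<union> T1.anc t \<times> {k}"
    using assms T1.anc_root T2.self_in_anc by (fastforce simp: route_def)
  from linkedI[OF cyclic_path_snoc[OF s E2 \<kappa>2_root this]] show ?thesis
    using assms T1.root_in wilds_le[of t] by simp
qed

text \<open>Outside the two exceptional cases, the route in one of the two directions is free of
  collisions: if both were blocked by their ancestor conditions, antisymmetry would make the two
  vertices equal.\<close>

lemma all_linked:
  assumes row: "\<And>u x. \<lbrakk>u \<in> V1; x \<in> V1; u \<noteq> r1; x \<noteq> r1; u \<noteq> x\<rbrakk> \<Longrightarrow> linked E \<kappa> (u, r2) (x, r2)"
    and col: "\<And>v z. \<lbrakk>v \<in> V2; z \<in> V2; v \<noteq> r2; z \<noteq> r2; z \<notin> T2.anc v\<rbrakk> \<Longrightarrow> linked E \<kappa> (r1, v) (r1, z)"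
    and mem: "u \<in> V1" "v \<in> V2" "x \<in> V1" "z \<in> V2" and ne: "(u, v) \<noteq> (x, z)"
  shows "linked E \<kappa> (u, v) (x, z)"
proof -
  consider (row) "v = r2" "z = r2" "u \<noteq> r1" "x \<noteq> r1" | (col) "u = r1" "x = r1" "v \<noteq> r2" "z \<noteq> r2"
    | (forth) "v = r2 \<Longrightarrow> u = r1" "x = r1 \<Longrightarrow> z = r2" "x \<in> T1.anc u \<Longrightarrow> v \<notin> T2.anc z"
    | (reverse) "z = r2 \<Longrightarrow> x = r1" "u = r1 \<Longrightarrow> v = r2" "u \<in> T1.anc x \<Longrightarrow> z \<notin> T2.anc v"
  proof -
    have a: "x \<in> T1.anc u \<Longrightarrow> u \<in> T1.anc x \<Longrightarrow> u = x" "v \<in> T2.anc z \<Longrightarrow> z \<in> T2.anc v \<Longrightarrow> v = z"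
      using T1.anc_antisym T2.anc_antisym mem by auto
    show ?thesis
      using that a ne T1.anc_root T2.anc_root
      by (cases "v = r2"; cases "z = r2"; cases "u = r1"; cases "x = r1") auto
  qed
  then show ?thesis
  proof cases
    case row
    then show ?thesis using assms by blast
  next
    case col
    show ?thesis
    proof (cases "z \<in> T2.anc v")
      case True
      then have "v \<notin> T2.anc z" using T2.anc_antisym mem ne col by blast
      then show ?thesis using assms(2)[of z v] col mem linked_sym[of E \<kappa>] by blast
    qed (use assms(2)[of v z] col mem in blast)
  next
    case forth
    then show ?thesis using route_linked mem by blast
  next
    case reverse
    then show ?thesis using route_linked[of x z u v] mem linked_sym[of E \<kappa>] by blast
  qed
qed

end

section \<open>From cyclic colorings to bounds on \<open>pc\<^sub>1\<^sub>2\<close>\<close>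

text \<open>Integer colors on ordered pairs allow residues of signed sums. For \<open>k = 3\<close>
  the range excludes the extra color; for \<open>k = 4\<close> it is included.\<close>

definition cyclically_colorable :: "'v pair_pre_digraph \<Rightarrow> nat \<Rightarrow> bool" where
  "cyclically_colorable F k \<longleftrightarrow> (\<exists>\<kappa>. (\<forall>x y. \<kappa> x y = \<kappa> y x) \<and> (\<forall>x y. (x, y) \<in> parcs F \<longrightarrow> \<kappa> x y \<in> {0..<int k}) \<and>
     (\<forall>x\<in>pverts F. \<forall>y\<in>pverts F. x \<noteq> y \<longrightarrow> linked (\<lambda>x y. (x, y) \<in> parcs F) \<kappa> x y))"

lemma apath_of_cyclic_path:
  assumes "pair_graph F" "cyclic_path (\<lambda>x y. (x, y) \<in> parcs F) \<kappa> p x S n q y" "x \<in> pverts F"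
  shows "\<exists>es. pre_digraph.apath (with_proj F) x es y \<and> set (pawalk_verts x es) = S \<and>
    (\<forall>i<length es. \<kappa> (fst (es ! i)) (snd (es ! i)) \<in> {(p + i) mod 3, 3}) \<and>
    length (filter (\<lambda>e. \<kappa> (fst e) (snd e) = 3) es) = n"
proof -
  interpret F: pair_graph F by fact
  show ?thesis using assms(2,3)
  proof (induction rule: cyclic_path.induct)
    case (refl p q x)
    then show ?case by (intro exI[of _ "[]"]) (auto simp: F.apath_Nil_iff)
  next
    case (step x y p S n q z)
    then obtain es where es: "F.apath y es z" "set (pawalk_verts y es) = S"
      "\<forall>i<length es. \<kappa> (fst (es ! i)) (snd (es ! i)) \<in> {(p + 1 + i) mod 3, 3}"
      "length (filter (\<lambda>e. \<kappa> (fst e) (snd e) = 3) es) = n"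
      using F.in_arcsD2 by blast
    have "\<kappa> (fst (((x, y) # es) ! i)) (snd (((x, y) # es) ! i)) \<in> {(p + i) mod 3, 3}"
      if "i < length ((x, y) # es)" for i
    proof (cases i)
      case (Suc j)
      then show ?thesis using es(3) that by (auto simp: algebra_simps)
    qed (use step in simp)
    moreover have "\<kappa> x y \<noteq> 3"
      using step.hyps(2) pos_mod_bound[of 3 p] by simp
    ultimately show ?case using es step.hyps
      by (intro exI[of _ "(x, y) # es"]) (simp add: F.apath_Cons_iff)
  next
    case (wild x y S p n q z)
    then obtain es where es: "F.apath y es z" "set (pawalk_verts y es) = S"
      "\<forall>i<length es. \<kappa> (fst (es ! i)) (snd (es ! i)) \<in> {(p + 1 + i) mod 3, 3}"
      "length (filter (\<lambda>e. \<kappa> (fst e) (snd e) = 3) es) = n"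
      using F.in_arcsD2 by blast
    have "\<kappa> (fst (((x, y) # es) ! i)) (snd (((x, y) # es) ! i)) \<in> {(p + i) mod 3, 3}"
      if "i < length ((x, y) # es)" for i
    proof (cases i)
      case (Suc j)
      then show ?thesis using es(3) that by (auto simp: algebra_simps)
    qed (use wild in simp)
    then show ?case using es wild.hyps
      by (intro exI[of _ "(x, y) # es"]) (simp add: F.apath_Cons_iff)
  qed
qed

lemma length_rev_path [simp]: "length (rev_path p) = length p"
  by (induction p) auto

lemma nth_rev_path: "i < length p \<Longrightarrow> edge (rev_path p ! i) = edge (p ! (length p - 1 - i))"
  by (induction p) (auto simp: nth_append nth_Cons' edge_def less_Suc_eq)

lemma distance2_proper_path_rev:
  assumes "pair_graph F" "distance2_proper_path F c x p y"
  shows "distance2_proper_path F c y (rev_path p) x"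
proof -
  interpret F: pair_graph F by fact
  have "\<not> j - i - 1 < 2" if "i < j" "j < length p" "c (edge (rev_path p ! i)) = c (edge (rev_path p ! j))" for i j
  proof -
    have "length p - 1 - j < length p - 1 - i" "length p - 1 - i < length p"
      using that by auto
    moreover have "c (edge (p ! (length p - 1 - j))) = c (edge (p ! (length p - 1 - i)))"
      using that by (simp add: nth_rev_path)
    ultimately have "\<not> (length p - 1 - i) - (length p - 1 - j) - 1 < 2"
      using assms(2) unfolding distance2_proper_path_def by blast
    then show ?thesis using that by simp
  qed
  then show ?thesis using assms(2) unfolding distance2_proper_path_def by simp
qed

lemma proper_coloring_of_cyclic:
  assumes F: "pair_graph F" and "cyclically_colorable F k"
  shows "\<exists>c. proper_connecting_coloring F c \<and> card (c ` edges F) \<le> k"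
proof -
  interpret F: pair_graph F by fact
  obtain \<kappa> where sym: "\<And>x y. \<kappa> x y = \<kappa> y x"
    and range: "\<And>x y. (x, y) \<in> parcs F \<Longrightarrow> \<kappa> x y \<in> {0..<int k}"
    and linked: "\<And>x y. x \<in> pverts F \<Longrightarrow> y \<in> pverts F \<Longrightarrow> x \<noteq> y \<Longrightarrow> linked (\<lambda>x y. (x, y) \<in> parcs F) \<kappa> x y"
    using assms(2) unfolding cyclically_colorable_def by blast
  \<comment> \<open>An arbitrary orientation of the edge is chosen; the symmetry of
    \<open>\<kappa>\<close> makes the choice irrelevant.\<close>
  define c where "c e = nat (let a = SOME a. e = edge a in \<kappa> (fst a) (snd a))" for e
  have c: "c (edge a) = nat (\<kappa> (fst a) (snd a))" for a
  proof -
    define b where "b = (SOME b. edge a = edge b)"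
    have "edge a = edge b" unfolding b_def by (rule someI) simp
    then have "fst a = fst b \<and> snd a = snd b \<or> fst a = snd b \<and> snd a = fst b"
      by (simp add: edge_def doubleton_eq_iff)
    then have "\<kappa> (fst b) (snd b) = \<kappa> (fst a) (snd a)" using sym by metis
    then show ?thesis by (simp add: c_def b_def)
  qed
  have "c ` edges F \<subseteq> {..<k}"
    using range by (force simp: edges_def c)
  then have "card (c ` edges F) \<le> k"
    by (metis card_lessThan card_mono finite_lessThan)
  have path: "\<exists>es. distance2_proper_path F c x es y"
    if s: "cyclic_path (\<lambda>x y. (x, y) \<in> parcs F) \<kappa> p x S n q y" "n \<le> 1" "x \<in> pverts F" for p x S n q y
  proof -
    obtain es where es: "F.apath x es y"
      and col: "\<And>i. i < length es \<Longrightarrow> \<kappa> (fst (es ! i)) (snd (es ! i)) \<in> {(p + i) mod 3, 3}"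
      and n: "length (filter (\<lambda>e. \<kappa> (fst e) (snd e) = 3) es) = n"
      using apath_of_cyclic_path[OF F s(1,3)] by blast
    \<comment> \<open>Equal residues force the positions to differ by a multiple of 3, while here
      they differ by 1 or 2; the color 3 occurs at most once.\<close>
    have "\<not> j - i - 1 < 2" if "i < j" "j < length es" "c (edge (es ! i)) = c (edge (es ! j))" for i j
    proof
      assume ji: "j - i - 1 < 2"
      let ?col = "\<lambda>i. \<kappa> (fst (es ! i)) (snd (es ! i))"
      have "set es \<subseteq> parcs F" using es by (auto simp: F.apath_def F.awalk_def)
      then have "es ! i \<in> parcs F" "es ! j \<in> parcs F" using that by auto
      then have "0 \<le> ?col i" "0 \<le> ?col j"
        using range by (metis atLeastLessThan_iff prod.collapse)+
      then have eq: "?col i = ?col j"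
        using that(3) unfolding c by simp
      show False
      proof (cases "?col i = 3")
        case True
        then have "{i, j} \<subseteq> {i. i < length es \<and> ?col i = 3}" using that eq by auto
        then have "card {i, j} \<le> n"
          unfolding n[symmetric] length_filter_conv_card by (intro card_mono) auto
        then show False using that s(2) by simp
      next
        case False
        then have "(p + i) mod 3 = (p + j) mod 3"
          using col[of i] col[of j] eq that by auto
        then have "int j - int i = 3 * ((p + j) div 3 - (p + i) div 3)"
          by (simp add: minus_mod_eq_mult_div[symmetric] algebra_simps)
        then show False using that ji by presburger
      qed
    qed
    then show ?thesis using es unfolding distance2_proper_path_def by blast
  qed
  have "proper_connecting_coloring F c"
    unfolding proper_connecting_coloring_def
  proof (intro ballI impI)
    fix x y assume xy: "x \<in> pverts F" "y \<in> pverts F" "x \<noteq> y"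
    from linked[OF xy] show "\<exists>p. distance2_proper_path F c x p y"
      unfolding linked_def
      using path[of _ x _ _ _ y] path[of _ y _ _ _ x] xy distance2_proper_path_rev[OF F] by blast
  qed
  then show ?thesis using \<open>card (c ` edges F) \<le> k\<close> by blast
qed

lemma pc_le_of_cyclic:
  assumes "pair_graph F" "cyclically_colorable F k"
  shows "pc\<^sub>1\<^sub>2 F \<le> k"
proof -
  obtain c where c: "proper_connecting_coloring F c" "card (c ` edges F) \<le> k"
    using proper_coloring_of_cyclic[OF assms] by blast
  have "pc\<^sub>1\<^sub>2 F \<le> card (c ` edges F)"
    unfolding pc\<^sub>1\<^sub>2_def by (rule Least_le) (use c in blast)
  then show ?thesis using c by simp
qed

lemma parcs_cartesian_product_iff:
  assumes "pair_graph G" "pair_graph H"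
  shows "((u, v), (x, y)) \<in> parcs (G \<box> H) \<longleftrightarrow>
    (u, x) \<in> parcs G \<and> v = y \<and> v \<in> pverts H \<or> (v, y) \<in> parcs H \<and> u = x \<and> u \<in> pverts G"
proof -
  interpret G: pair_graph G by fact
  interpret H: pair_graph H by fact
  have "(a, a) \<notin> parcs G" "(b, b) \<notin> parcs H" for a b
    using G.pair_no_loops[of "(a, a)"] H.pair_no_loops[of "(b, b)"] by auto
  then show ?thesis
    by (auto simp: cartesian_product_def dest: G.in_arcsD1 G.in_arcsD2 H.in_arcsD1 H.in_arcsD2)
qed

lemma cyclically_colorable_swap:
  assumes "pair_graph G" "pair_graph H" "cyclically_colorable (G \<box> H) k"
  shows "cyclically_colorable (H \<box> G) k"
proof -
  obtain \<kappa> where \<kappa>: "\<And>x y. \<kappa> x y = \<kappa> y x" "\<And>x y. (x, y) \<in> parcs (G \<box> H) \<Longrightarrow> \<kappa> x y \<in> {0..<int k}"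
    "\<And>x y. x \<in> pverts (G \<box> H) \<Longrightarrow> y \<in> pverts (G \<box> H) \<Longrightarrow> x \<noteq> y \<Longrightarrow> linked (\<lambda>x y. (x, y) \<in> parcs (G \<box> H)) \<kappa> x y"
    using assms(3) unfolding cyclically_colorable_def by blast
  define \<kappa>' where "\<kappa>' x y = \<kappa> (prod.swap x) (prod.swap y)" for x y
  have arcs: "(prod.swap x, prod.swap y) \<in> parcs (H \<box> G) \<longleftrightarrow> (x, y) \<in> parcs (G \<box> H)" for x y
    by (cases x; cases y) (auto simp: parcs_cartesian_product_iff assms(1,2))
  have "linked (\<lambda>x y. (x, y) \<in> parcs (H \<box> G)) \<kappa>' (prod.swap x) (prod.swap y)"
    if "x \<in> pverts (G \<box> H)" "y \<in> pverts (G \<box> H)" "x \<noteq> y" for x y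
    by (rule linked_map[OF \<kappa>(3)[OF that]]) (auto simp: arcs \<kappa>'_def)
  moreover have "prod.swap x \<in> pverts (G \<box> H)" if "x \<in> pverts (H \<box> G)" for x
    using that by (auto simp: cartesian_product_def)
  ultimately have "linked (\<lambda>x y. (x, y) \<in> parcs (H \<box> G)) \<kappa>' x y"
    if "x \<in> pverts (H \<box> G)" "y \<in> pverts (H \<box> G)" "x \<noteq> y" for x y
    using that by (metis swap_swap)
  moreover have "\<kappa>' x y \<in> {0..<int k}" if "(x, y) \<in> parcs (H \<box> G)" for x y
    using that \<kappa>(2) arcs[of "prod.swap x" "prod.swap y"] by (simp add: \<kappa>'_def)
  moreover have "\<kappa>' x y = \<kappa>' y x" for x y
    using \<kappa>(1) by (simp add: \<kappa>'_def)
  ultimately show ?thesis unfolding cyclically_colorable_def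
    by (intro exI[of _ \<kappa>']) blast
qed

section \<open>The lower bound\<close>

lemma nonadjacent_of_not_complete:
  assumes "pair_graph G" "\<not> complete_graph G"
  obtains u x where "u \<in> pverts G" "x \<in> pverts G" "u \<noteq> x" "(u, x) \<notin> parcs G"
proof -
  interpret G: pair_graph G by fact
  have "parcs G \<noteq> {(u, v). (u, v) \<in> pverts G \<times> pverts G \<and> u \<noteq> v}"
    using assms(2) G.pair_finite_verts unfolding complete_graph_def complete_digraph_pair_def by blast
  moreover have "parcs G \<subseteq> {(u, v). (u, v) \<in> pverts G \<times> pverts G \<and> u \<noteq> v}"
    using G.pair_no_loops[of "(_, _)"] by (auto dest: G.in_arcsD1 G.in_arcsD2)
  ultimately show ?thesis using that by auto
qed

text \<open>Any path between vertices at distance at least three has three initial edges, and these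
  have pairwise fewer than two edges in between.\<close>

lemma three_le_card_colors:
  assumes F: "pair_graph F" and c: "proper_connecting_coloring F c"
    and xy: "x \<in> pverts F" "y \<in> pverts F" "x \<noteq> y" "(x, y) \<notin> parcs F"
    and far: "\<And>a. (x, a) \<in> parcs F \<Longrightarrow> (a, y) \<notin> parcs F"
  shows "3 \<le> card (c ` edges F)"
proof -
  interpret F: pair_graph F by fact
  obtain p where p: "F.apath x p y"
    and d: "\<And>i j. i < j \<Longrightarrow> j < length p \<Longrightarrow> c (edge (p ! i)) = c (edge (p ! j)) \<Longrightarrow> \<not> j - i - 1 < 2"
    using c xy unfolding proper_connecting_coloring_def distance2_proper_path_def by blast
  have walk: "F.awalk x p y" using p by (simp add: F.apath_def)
  obtain e1 e2 e3 q where q: "p = e1 # e2 # e3 # q"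
  proof (cases p)
    case Nil
    then show ?thesis using walk xy by (simp add: F.awalk_Nil_iff)
  next
    case p1: (Cons e1 p')
    show ?thesis
    proof (cases p')
      case Nil
      then show ?thesis using walk xy p1
        by (cases e1) (auto simp: F.awalk_simps)
    next
      case p2: (Cons e2 p'')
      show ?thesis
      proof (cases p'')
        case Nil
        then show ?thesis using walk far[of "snd e1"] p1 p2
          by (cases e1; cases e2) (auto simp: F.awalk_simps)
      qed (use that p1 p2 in blast)
    qed
  qed
  have "c (edge e1) \<noteq> c (edge e2)" "c (edge e1) \<noteq> c (edge e3)" "c (edge e2) \<noteq> c (edge e3)"
    using d[of 0 1] d[of 0 2] d[of 1 2] by (auto simp: q)
  then have "card {c (edge e1), c (edge e2), c (edge e3)} = 3" by simp
  moreover have "{c (edge e1), c (edge e2), c (edge e3)} \<subseteq> c ` edges F"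
    using walk by (auto simp: q F.awalk_Cons_iff edges_def)
  moreover have "finite (c ` edges F)"
    by (simp add: edges_def F.pair_finite_arcs)
  ultimately show ?thesis by (metis card_mono)
qed

text \<open>Distances add up in the product: at least 2 in the first factor and at least 1 in the
  second.\<close>

lemma far_vertices_cartesian_product:
  assumes G: "pair_graph G" and H: "pair_graph H"
    and ux: "u \<in> pverts G" "x \<in> pverts G" "u \<noteq> x" "(u, x) \<notin> parcs G"
    and vy: "v \<in> pverts H" "y \<in> pverts H" "v \<noteq> y"
  shows "((u, v), (x, y)) \<notin> parcs (G \<box> H)"
    and "((u, v), a) \<in> parcs (G \<box> H) \<Longrightarrow> (a, (x, y)) \<notin> parcs (G \<box> H)"
  using ux vy by (cases a; auto simp: parcs_cartesian_product_iff[OF G H])+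

lemma three_le_pc_product:
  assumes G: "pair_graph G" and H: "pair_graph H"
    and "nontrivial G" "nontrivial H" "\<not> (complete_graph G \<and> complete_graph H)"
    and ex: "proper_connecting_coloring (G \<box> H) c0"
  shows "3 \<le> pc\<^sub>1\<^sub>2 (G \<box> H)"
proof -
  have GH: "pair_graph (G \<box> H)" "pair_graph (H \<box> G)"
    using G H by (simp_all add: pair_graph_cartesian_product)
  have two: "\<exists>a\<in>pverts F. \<exists>b\<in>pverts F. a \<noteq> b" if "nontrivial F" for F :: "'c pair_pre_digraph"
    using that unfolding nontrivial_def
    by (metis card_le_Suc0_iff_eq card.infinite not_less_eq_eq numeral_2_eq_2 zero_le)
  have bound: "3 \<le> card (c ` edges (G \<box> H))" if c: "proper_connecting_coloring (G \<box> H) c" for c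
  proof (cases "complete_graph G")
    case False
    obtain u x where ux: "u \<in> pverts G" "x \<in> pverts G" "u \<noteq> x" "(u, x) \<notin> parcs G"
      using nonadjacent_of_not_complete[OF G False] by metis
    obtain v y where vy: "v \<in> pverts H" "y \<in> pverts H" "v \<noteq> y" using two assms by metis
    show ?thesis
      using three_le_card_colors[OF GH(1) c, of "(u, v)" "(x, y)"]
        far_vertices_cartesian_product[OF G H ux vy] ux vy
      by (auto simp: cartesian_product_def)
  next
    case True
    then have "\<not> complete_graph H" using assms by blast
    then obtain v y where vy: "v \<in> pverts H" "y \<in> pverts H" "v \<noteq> y" "(v, y) \<notin> parcs H"
      using nonadjacent_of_not_complete[OF H] by metis
    obtain u x where ux: "u \<in> pverts G" "x \<in> pverts G" "u \<noteq> x" using two assms by metis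
    have "((u, v), (x, y)) \<notin> parcs (G \<box> H)"
      using ux vy by (auto simp: parcs_cartesian_product_iff[OF G H])
    moreover have "(a, (x, y)) \<notin> parcs (G \<box> H)" if "((u, v), a) \<in> parcs (G \<box> H)" for a
      using that ux vy by (cases a) (auto simp: parcs_cartesian_product_iff[OF G H])
    ultimately show ?thesis
      using three_le_card_colors[OF GH(1) c, of "(u, v)" "(x, y)"] ux vy
      by (auto simp: cartesian_product_def)
  qed
  \<comment> \<open>\<open>LEAST\<close> says nothing about an empty set; the coloring
    \<open>c0\<close> guarantees that the minimum is attained.\<close>
  have "\<exists>c. proper_connecting_coloring (G \<box> H) c \<and> card (c ` edges (G \<box> H)) = pc\<^sub>1\<^sub>2 (G \<box> H)"
    unfolding pc\<^sub>1\<^sub>2_def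
    by (rule LeastI_ex) (use ex in blast)
  then show ?thesis using bound by metis
qed

section \<open>The coloring obtained from two spanning trees\<close>

definition rooted_spanning_tree :: "'a pair_pre_digraph \<Rightarrow> 'a \<Rightarrow> ('a \<Rightarrow> 'a) \<Rightarrow> ('a \<Rightarrow> nat) \<Rightarrow> bool" where
  "rooted_spanning_tree F r par lev \<longleftrightarrow>
     rooted_tree (pverts F) r par lev \<and> (\<forall>v\<in>pverts F. v \<noteq> r \<longrightarrow> (v, par v) \<in> parcs F)"

text \<open>
  The second case concerns the edges of layer \<open>v\<close> whose ends are not on consecutive levels. It is
  relevant only when the first factor is a triangle.
\<close>

definition tree_coloring ::
    "bool \<Rightarrow> 'a \<Rightarrow> ('a \<Rightarrow> nat) \<Rightarrow> 'b \<Rightarrow> ('b \<Rightarrow> nat) \<Rightarrow> 'a \<times> 'b \<Rightarrow> 'a \<times> 'b \<Rightarrow> int" where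
  "tree_coloring w r1 l1 r2 l2 = (\<lambda>(u, v) (x, y).
     if v = y then
       let i = max (l1 u) (l1 x)
       in if i \<noteq> Suc (min (l1 u) (l1 x)) then int (l2 v) mod 3
          else if v = r2 then int i mod 3
          else if w \<and> i = 1 then 3
          else (1 - int i - int (l2 v)) mod 3
     else if u = x then
       let j = int (max (l2 v) (l2 y))
       in if u = r1 then (1 - j) mod 3 else (int (l1 u) + j) mod 3
     else 0)"

lemma tree_coloring_sym: "tree_coloring w r1 l1 r2 l2 a b = tree_coloring w r1 l1 r2 l2 b a"
  by (auto simp: tree_coloring_def Let_def max.commute min.commute split: prod.splits)

lemma tree_coloring_range: "tree_coloring w r1 l1 r2 l2 a b \<in> {0..<(if w then 4 else 3)}"
proof -
  have "x mod 3 < 4" for x :: int using pos_mod_bound[of 3 x] by simp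
  then show ?thesis by (auto simp: tree_coloring_def Let_def split: prod.splits)
qed

lemma tree_product_tree_coloring:
  assumes G: "pair_graph G" "rooted_spanning_tree G r1 p1 l1"
    and H: "pair_graph H" "rooted_spanning_tree H r2 p2 l2"
  shows "tree_product (pverts G) r1 p1 l1 (pverts H) r2 p2 l2 (\<lambda>x y. (x, y) \<in> parcs (G \<box> H))
    (tree_coloring w r1 l1 r2 l2) w"
proof -
  interpret G: pair_graph G by fact
  interpret H: pair_graph H by fact
  interpret GH: pair_graph "G \<box> H" using G H by (simp add: pair_graph_cartesian_product)
  interpret T1: rooted_tree "pverts G" r1 p1 l1 using G by (simp add: rooted_spanning_tree_def)
  interpret T2: rooted_tree "pverts H" r2 p2 l2 using H by (simp add: rooted_spanning_tree_def)
  have p1: "(u, p1 u) \<in> parcs G" if "u \<in> pverts G" "u \<noteq> r1" for u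
    using G that by (simp add: rooted_spanning_tree_def)
  have p2: "(v, p2 v) \<in> parcs H" if "v \<in> pverts H" "v \<noteq> r2" for v
    using H that by (simp add: rooted_spanning_tree_def)
  \<comment> \<open>On a tree edge the larger level is that of the child, so a coloring symmetric in
    both ends can still refer to the child.\<close>
  have l1: "max (l1 u) (l1 (p1 u)) = l1 u" "l1 u = Suc (min (l1 u) (l1 (p1 u)))"
    if "u \<in> pverts G" "u \<noteq> r1" for u
    using T1.lev_par[OF that] by auto
  have l2: "max (l2 v) (l2 (p2 v)) = l2 v" if "v \<in> pverts H" "v \<noteq> r2" for v
    using T2.lev_par[OF that] by simp
  have l2': "v \<noteq> p2 v" if "v \<in> pverts H" "v \<noteq> r2" for v
    using T2.lev_par[OF that] by (metis n_not_Suc_n)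
  note iff = parcs_cartesian_product_iff[OF G(1) H(1)]
  show ?thesis
  proof
    fix x y assume "(x, y) \<in> parcs (G \<box> H)"
    then show "(y, x) \<in> parcs (G \<box> H)" by (rule GH.arcs_symmetric)
  next
    fix u v assume "u \<in> pverts G" "l1 u = 1" "v \<in> pverts H" "v \<noteq> r2" w
    moreover from this have "u \<noteq> r1" using T1.lev_root by auto
    ultimately show "tree_coloring w r1 l1 r2 l2 (u, v) (p1 u, v) = 3"
      using l1[of u] by (simp add: tree_coloring_def Let_def)
  next
    fix u v assume "u \<in> pverts G" "u \<noteq> r1" "v \<in> pverts H" "v \<noteq> r2" "\<not> (w \<and> l1 u = 1)"
    then show "tree_coloring w r1 l1 r2 l2 (u, v) (p1 u, v) = (1 - int (l1 u) - int (l2 v)) mod 3"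
      using l1[of u] by (auto simp: tree_coloring_def Let_def)
  next
    fix u assume "u \<in> pverts G" "u \<noteq> r1"
    then show "tree_coloring w r1 l1 r2 l2 (u, r2) (p1 u, r2) = int (l1 u) mod 3"
      using l1[of u] by (simp add: tree_coloring_def Let_def)
  qed (auto simp: iff p1 p2 l2 l2' tree_coloring_def Let_def max.commute min.commute split: prod.splits)
qed

lemma cyclically_colorable_of_levels:
  assumes G: "pair_graph G" "rooted_spanning_tree G r1 p1 l1"
    and H: "pair_graph H" "rooted_spanning_tree H r2 p2 l2"
    and 1: "\<And>u. u \<in> pverts G \<Longrightarrow> u \<noteq> r1 \<Longrightarrow> \<exists>t\<in>pverts H. t \<noteq> r2 \<and> 3 dvd l1 u + l2 t"
    and 2: "\<And>v. v \<in> pverts H \<Longrightarrow> v \<noteq> r2 \<Longrightarrow> \<exists>t\<in>pverts G. t \<noteq> r1 \<and> 3 dvd l2 v + l1 t"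
  shows "cyclically_colorable (G \<box> H) 3"
proof -
  interpret P: tree_product "pverts G" r1 p1 l1 "pverts H" r2 p2 l2 "\<lambda>x y. (x, y) \<in> parcs (G \<box> H)"
    "tree_coloring False r1 l1 r2 l2" False
    by (rule tree_product_tree_coloring[OF G H])
  have "linked (\<lambda>x y. (x, y) \<in> parcs (G \<box> H)) (tree_coloring False r1 l1 r2 l2) (u, v) (x, z)"
    if "u \<in> pverts G" "v \<in> pverts H" "x \<in> pverts G" "z \<in> pverts H" "(u, v) \<noteq> (x, z)" for u v x z
  proof (rule P.all_linked[OF _ _ that])
    show "linked (\<lambda>x y. (x, y) \<in> parcs (G \<box> H)) (tree_coloring False r1 l1 r2 l2) (u, r2) (x, r2)"
      if "u \<in> pverts G" "x \<in> pverts G" "u \<noteq> r1" "x \<noteq> r1" "u \<noteq> x" for u x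
      using P.row_linked[OF that] 1 by blast
    show "linked (\<lambda>x y. (x, y) \<in> parcs (G \<box> H)) (tree_coloring False r1 l1 r2 l2) (r1, v) (r1, z)"
      if "v \<in> pverts H" "z \<in> pverts H" "v \<noteq> r2" "z \<noteq> r2" "z \<notin> P.T2.anc v" for v z
      using P.column_linked[OF that] 2[OF that(2,4)] by (metis add.commute)
  qed
  moreover have "tree_coloring False r1 l1 r2 l2 a b \<in> {0..<int 3}" for a b
    using tree_coloring_range[of False] by simp
  ultimately show ?thesis unfolding cyclically_colorable_def
    by (intro exI[of _ "tree_coloring False r1 l1 r2 l2"])
      (use tree_coloring_sym in \<open>auto simp: cartesian_product_def[of G H]\<close>)
qed

text \<open>The extra color settles column \<open>r1\<close>, so complementary levels are required
  only in the tree of \<open>H\<close>; of \<open>G\<close>, a single vertex on level one is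
  enough.\<close>

lemma cyclically_colorable_wild:
  assumes G: "pair_graph G" "rooted_spanning_tree G r1 p1 l1"
    and H: "pair_graph H" "rooted_spanning_tree H r2 p2 l2"
    and 1: "\<And>u. u \<in> pverts G \<Longrightarrow> u \<noteq> r1 \<Longrightarrow> \<exists>t\<in>pverts H. t \<noteq> r2 \<and> 3 dvd l1 u + l2 t"
    and 2: "t \<in> pverts G" "l1 t = 1"
  shows "cyclically_colorable (G \<box> H) 4"
proof -
  interpret P: tree_product "pverts G" r1 p1 l1 "pverts H" r2 p2 l2 "\<lambda>x y. (x, y) \<in> parcs (G \<box> H)"
    "tree_coloring True r1 l1 r2 l2" True
    by (rule tree_product_tree_coloring[OF G H])
  have "linked (\<lambda>x y. (x, y) \<in> parcs (G \<box> H)) (tree_coloring True r1 l1 r2 l2) (u, v) (x, z)"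
    if "u \<in> pverts G" "v \<in> pverts H" "x \<in> pverts G" "z \<in> pverts H" "(u, v) \<noteq> (x, z)" for u v x z
  proof (rule P.all_linked[OF _ _ that])
    show "linked (\<lambda>x y. (x, y) \<in> parcs (G \<box> H)) (tree_coloring True r1 l1 r2 l2) (u, r2) (x, r2)"
      if "u \<in> pverts G" "x \<in> pverts G" "u \<noteq> r1" "x \<noteq> r1" "u \<noteq> x" for u x
      using P.row_linked[OF that] 1 by blast
    show "linked (\<lambda>x y. (x, y) \<in> parcs (G \<box> H)) (tree_coloring True r1 l1 r2 l2) (r1, v) (r1, z)"
      if "v \<in> pverts H" "z \<in> pverts H" "v \<noteq> r2" "z \<noteq> r2" "z \<notin> P.T2.anc v" for v z
      using P.column_linked_wild[OF that 2] by blast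
  qed
  moreover have "tree_coloring True r1 l1 r2 l2 a b \<in> {0..<int 4}" for a b
    using tree_coloring_range[of True] by simp
  ultimately show ?thesis unfolding cyclically_colorable_def
    by (intro exI[of _ "tree_coloring True r1 l1 r2 l2"])
      (use tree_coloring_sym in \<open>auto simp: cartesian_product_def[of G H]\<close>)
qed

lemma (in rooted_tree) ex_lev:
  "v \<in> V \<Longrightarrow> n \<le> lev v \<Longrightarrow> \<exists>t\<in>V. lev t = n"
proof (induction rule: tree_induct)
  case root
  then show ?case using root_in lev_root by auto
next
  case (child v)
  then show ?case using lev_par by (cases "n = lev v") auto
qed

lemma ex_complementary_level:
  assumes "rooted_spanning_tree H r par lev" "v \<in> pverts H" "lev v = 3"
  shows "\<exists>t\<in>pverts H. t \<noteq> r \<and> 3 dvd n + lev t"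
proof -
  interpret T: rooted_tree "pverts H" r par lev using assms by (simp add: rooted_spanning_tree_def)
  \<comment> \<open>The level sought lies between 1 and 3: the residue 0 is represented by 3, since
    level 0 is the excluded root.\<close>
  have "\<exists>t\<in>pverts H. lev t = 3 - n mod 3"
    by (rule T.ex_lev[OF assms(2)]) (simp add: assms)
  then obtain t where t: "t \<in> pverts H" "lev t = 3 - n mod 3" by blast
  have "3 dvd n + lev t" "lev t \<noteq> 0" unfolding t by presburger+
  then show ?thesis using t T.lev_root by metis
qed

lemma cyclically_colorable_deep:
  assumes "pair_graph G" "rooted_spanning_tree G r1 p1 l1" "a \<in> pverts G" "l1 a = 3"
    and "pair_graph H" "rooted_spanning_tree H r2 p2 l2" "b \<in> pverts H" "l2 b = 3"
  shows "cyclically_colorable (G \<box> H) 3"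
  using cyclically_colorable_of_levels[OF assms(1,2,5,6)]
    ex_complementary_level[OF assms(2-4)] ex_complementary_level[OF assms(6-8)]
  by blast

text \<open>Only the levels 1 and 2 occur off the roots, and they are complementary to each
  other.\<close>

lemma cyclically_colorable_depth2:
  assumes G: "pair_graph G" "rooted_spanning_tree G r1 p1 l1" "\<And>u. u \<in> pverts G \<Longrightarrow> l1 u \<le> 2"
      "a \<in> pverts G" "l1 a = 2"
    and H: "pair_graph H" "rooted_spanning_tree H r2 p2 l2" "\<And>v. v \<in> pverts H \<Longrightarrow> l2 v \<le> 2"
      "b \<in> pverts H" "l2 b = 2"
  shows "cyclically_colorable (G \<box> H) 3"
proof -
  have compl: "\<exists>t\<in>pverts F. t \<noteq> r \<and> 3 dvd n + lev t"
    if F: "rooted_spanning_tree F r par lev" "c \<in> pverts F" "lev c = 2" and n: "n \<le> 2" "n \<noteq> 0"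
    for F :: "'c pair_pre_digraph" and r par lev c n
  proof -
    interpret T: rooted_tree "pverts F" r par lev using F by (simp add: rooted_spanning_tree_def)
    have "\<exists>t\<in>pverts F. lev t = 3 - n"
      by (rule T.ex_lev[OF F(2)]) (use F n in simp)
    then show ?thesis using T.lev_root n by force
  qed
  interpret T1: rooted_tree "pverts G" r1 p1 l1 using G by (simp add: rooted_spanning_tree_def)
  interpret T2: rooted_tree "pverts H" r2 p2 l2 using H by (simp add: rooted_spanning_tree_def)
  show ?thesis
    using cyclically_colorable_of_levels[OF G(1,2) H(1,2)]
      compl[OF G(2,4,5)] compl[OF H(2,4,5)] G(3) H(3) T1.lev_eq_0_iff T2.lev_eq_0_iff
    by metis
qed

text \<open>The triangle is rooted as the path \<open>c\<close>, \<open>a\<close>, \<open>b\<close>.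
  Its levels 1 and 2 serve the residues 2 and 1 of \<open>l2 z\<close>; the residue 0 is served by
  the edge from \<open>b\<close> to \<open>c\<close>.\<close>

lemma cyclically_colorable_triangle:
  assumes G: "pair_graph G" "pverts G = {c, a, b}" "a \<noteq> b" "a \<noteq> c" "b \<noteq> c"
      "(a, c) \<in> parcs G" "(b, a) \<in> parcs G" "(b, c) \<in> parcs G"
    and H: "pair_graph H" "rooted_spanning_tree H r2 p2 l2" "d \<in> pverts H" "l2 d = 3"
  shows "cyclically_colorable (G \<box> H) 3"
proof -
  define p1 where "p1 u = (if u = b then a else c)" for u
  define l1 :: "'a \<Rightarrow> nat" where "l1 u = (if u = c then 0 else if u = a then 1 else 2)" for u
  have T: "rooted_spanning_tree G c p1 l1"
    unfolding rooted_spanning_tree_def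
    by (intro conjI, unfold_locales) (use G in \<open>auto simp: p1_def l1_def\<close>)
  interpret P: tree_product "pverts G" c p1 l1 "pverts H" r2 p2 l2 "\<lambda>x y. (x, y) \<in> parcs (G \<box> H)"
    "tree_coloring False c l1 r2 l2" False
    by (rule tree_product_tree_coloring[OF G(1) T H(1,2)])
  have "linked (\<lambda>x y. (x, y) \<in> parcs (G \<box> H)) (tree_coloring False c l1 r2 l2) (u, v) (x, z)"
    if "u \<in> pverts G" "v \<in> pverts H" "x \<in> pverts G" "z \<in> pverts H" "(u, v) \<noteq> (x, z)" for u v x z
  proof (rule P.all_linked[OF _ _ that])
    show "linked (\<lambda>x y. (x, y) \<in> parcs (G \<box> H)) (tree_coloring False c l1 r2 l2) (u, r2) (x, r2)"
      if "u \<in> pverts G" "x \<in> pverts G" "u \<noteq> c" "x \<noteq> c" "u \<noteq> x" for u x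
      using P.row_linked[OF that] ex_complementary_level[OF H(2-4)] by blast
    show "linked (\<lambda>x y. (x, y) \<in> parcs (G \<box> H)) (tree_coloring False c l1 r2 l2) (c, v) (c, z)"
      if "v \<in> pverts H" "z \<in> pverts H" "v \<noteq> r2" "z \<noteq> r2" "z \<notin> P.T2.anc v" for v z
    proof -
      consider "l2 z mod 3 = 0" | "l2 z mod 3 = 1" | "l2 z mod 3 = 2" by linarith
      then show ?thesis
      proof cases
        case 1
        have "((b, z), (c, z)) \<in> parcs (G \<box> H)"
          using G H that by (simp add: parcs_cartesian_product_iff)
        \<comment> \<open>A descent reaches \<open>(b, z)\<close> in phase
          \<open>1 + 2 + int (l2 z)\<close>, which is \<open>int (l2 z)\<close> modulo 3; the color
          of edges between non-consecutive levels was chosen to match it.\<close>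
        moreover have "tree_coloring False c l1 r2 l2 (b, z) (c, z) = (1 + int (l1 b) + int (l2 z)) mod 3"
          using G(3-5) by (simp add: tree_coloring_def l1_def)
        ultimately show ?thesis
          using P.column_linked_edge[OF that, of b] G by simp
      next
        case 2
        then have "3 dvd l1 b + l2 z" using G(3-5) unfolding l1_def by simp presburger
        then show ?thesis using P.column_linked[OF that, of b] G by simp
      next
        case 3
        then have "3 dvd l1 a + l2 z" using G(3-5) unfolding l1_def by simp presburger
        then show ?thesis using P.column_linked[OF that, of a] G by simp
      qed
    qed
  qed
  moreover have "tree_coloring False c l1 r2 l2 x y \<in> {0..<int 3}" for x y
    using tree_coloring_range[of False] by simp
  ultimately show ?thesis unfolding cyclically_colorable_def
    by (intro exI[of _ "tree_coloring False c l1 r2 l2"])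
      (use tree_coloring_sym in \<open>auto simp: cartesian_product_def[of G H]\<close>)
qed

section \<open>The product of K2 with a tree of height two\<close>

text \<open>Both orientations are recorded so that explicit lists of vertices can be checked in
  either direction.\<close>

definition colored_edge :: "('v \<Rightarrow> 'v \<Rightarrow> bool) \<Rightarrow> ('v \<Rightarrow> 'v \<Rightarrow> int) \<Rightarrow> 'v \<Rightarrow> 'v \<Rightarrow> int \<Rightarrow> bool" where
  "colored_edge E \<kappa> x y c \<longleftrightarrow> E x y \<and> E y x \<and> \<kappa> x y = c \<and> \<kappa> y x = c"

text \<open>
  In the next three lemmas, \<open>a\<close> and \<open>b\<close> stand for the two copies of the second factor: \<open>ao\<close> is the copy
  of its root, \<open>ap\<close> that of an inner vertex of level one with child \<open>ak\<close>, and \<open>al\<close>, \<open>aq\<close>, \<open>ax\<close> are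
  leaves of level one. One leaf \<open>al\<close> gets colors different from those of all the others.
\<close>

lemma linked_first_leaf:
  assumes "distinct [ao, bo, ap, bp, ak, bk, al, bl]"
    and "colored_edge E \<kappa> ao bo 1"
      "colored_edge E \<kappa> ap bp 2"
      "colored_edge E \<kappa> ak bk 1"
      "colored_edge E \<kappa> al bl 0"
      "colored_edge E \<kappa> ap ao 0"
      "colored_edge E \<kappa> bp bo 2"
      "colored_edge E \<kappa> ak ap 2"
      "colored_edge E \<kappa> bk bp 0"
      "colored_edge E \<kappa> al ao 1"
      "colored_edge E \<kappa> bl bo 2"
  shows "linked E \<kappa> al ao"
    and "linked E \<kappa> al bo"
    and "linked E \<kappa> al ap"
    and "linked E \<kappa> al bp"
    and "linked E \<kappa> al ak"
    and "linked E \<kappa> al bk"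
    and "linked E \<kappa> bl ao"
    and "linked E \<kappa> bl bo"
    and "linked E \<kappa> bl ap"
    and "linked E \<kappa> bl bp"
    and "linked E \<kappa> bl ak"
    and "linked E \<kappa> bl bk"
    and "linked E \<kappa> al bl"
proof -
  have "distinct [bl, al, bk, ak, bp, ap, bo, ao]"
    using assms(1) by auto
  note [simp] = assms(1)[simplified] this[simplified] assms(2-)[unfolded colored_edge_def]
  show "linked E \<kappa> al ao"
    using linked_of_cyclic_run[of "[al, ao]" E \<kappa> 1] by simp
  show "linked E \<kappa> al bo"
    using linked_of_cyclic_run[of "[bo, bl, al]" E \<kappa> 2] by (simp add: linked_sym[of E \<kappa> al])
  show "linked E \<kappa> al ap"
    using linked_of_cyclic_run[of "[ap, ao, al]" E \<kappa> 0] by (simp add: linked_sym[of E \<kappa> al])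
  show "linked E \<kappa> al bp"
    using linked_of_cyclic_run[of "[bp, ap, ao, al]" E \<kappa> 2] by (simp add: linked_sym[of E \<kappa> al])
  show "linked E \<kappa> al ak"
    using linked_of_cyclic_run[of "[ak, ap, ao, al]" E \<kappa> 2] by (simp add: linked_sym[of E \<kappa> al])
  show "linked E \<kappa> al bk"
    using linked_of_cyclic_run[of "[bk, ak, ap, ao, al]" E \<kappa> 1] by (simp add: linked_sym[of E \<kappa> al])
  show "linked E \<kappa> bl ao"
    using linked_of_cyclic_run[of "[bl, al, ao]" E \<kappa> 0] by simp
  show "linked E \<kappa> bl bo"
    using linked_of_cyclic_run[of "[bl, bo]" E \<kappa> 2] by simp
  show "linked E \<kappa> bl ap"
    using linked_of_cyclic_run[of "[ap, ao, bo, bl]" E \<kappa> 0] by (simp add: linked_sym[of E \<kappa> bl])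
  show "linked E \<kappa> bl bp"
    using linked_of_cyclic_run[of "[bp, ap, ao, bo, bl]" E \<kappa> 2] by (simp add: linked_sym[of E \<kappa> bl])
  show "linked E \<kappa> bl ak"
    using linked_of_cyclic_run[of "[ak, ap, ao, bo, bl]" E \<kappa> 2] by (simp add: linked_sym[of E \<kappa> bl])
  show "linked E \<kappa> bl bk"
    using linked_of_cyclic_run[of "[bk, ak, ap, ao, bo, bl]" E \<kappa> 1] by (simp add: linked_sym[of E \<kappa> bl])
  show "linked E \<kappa> al bl"
    using linked_of_cyclic_run[of "[al, bl]" E \<kappa> 0] by simp
qed

lemma linked_leaf:
  assumes "distinct [ao, bo, ap, bp, ak, bk, al, bl, aq, bq]"
    and "colored_edge E \<kappa> ao bo 1"
      "colored_edge E \<kappa> ap bp 2"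
      "colored_edge E \<kappa> ak bk 1"
      "colored_edge E \<kappa> al bl 0"
      "colored_edge E \<kappa> aq bq 0"
      "colored_edge E \<kappa> ap ao 0"
      "colored_edge E \<kappa> bp bo 2"
      "colored_edge E \<kappa> ak ap 2"
      "colored_edge E \<kappa> bk bp 0"
      "colored_edge E \<kappa> al ao 1"
      "colored_edge E \<kappa> bl bo 2"
      "colored_edge E \<kappa> aq ao 2"
      "colored_edge E \<kappa> bq bo 1"
  shows "linked E \<kappa> aq ao"
    and "linked E \<kappa> aq bo"
    and "linked E \<kappa> aq ap"
    and "linked E \<kappa> aq bp"
    and "linked E \<kappa> aq ak"
    and "linked E \<kappa> aq bk"
    and "linked E \<kappa> aq al"
    and "linked E \<kappa> aq bl"
    and "linked E \<kappa> bq ao"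
    and "linked E \<kappa> bq bo"
    and "linked E \<kappa> bq ap"
    and "linked E \<kappa> bq bp"
    and "linked E \<kappa> bq ak"
    and "linked E \<kappa> bq bk"
    and "linked E \<kappa> bq al"
    and "linked E \<kappa> bq bl"
    and "linked E \<kappa> aq bq"
proof -
  have "distinct [bq, aq, bl, al, bk, ak, bp, ap, bo, ao]"
    using assms(1) by auto
  note [simp] = assms(1)[simplified] this[simplified] assms(2-)[unfolded colored_edge_def]
  show "linked E \<kappa> aq ao"
    using linked_of_cyclic_run[of "[aq, ao]" E \<kappa> 2] by simp
  show "linked E \<kappa> aq bo"
    using linked_of_cyclic_run[of "[aq, bq, bo]" E \<kappa> 0] by simp
  show "linked E \<kappa> aq ap"
    using linked_of_cyclic_run[of "[aq, ao, ap]" E \<kappa> 2] by simp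
  show "linked E \<kappa> aq bp"
    using linked_of_cyclic_run[of "[aq, bq, bo, bp]" E \<kappa> 0] by simp
  show "linked E \<kappa> aq ak"
    using linked_of_cyclic_run[of "[aq, bq, bo, bp, bk, ak]" E \<kappa> 0] by simp
  show "linked E \<kappa> aq bk"
    using linked_of_cyclic_run[of "[aq, bq, bo, bp, bk]" E \<kappa> 0] by simp
  show "linked E \<kappa> aq al"
    using linked_of_cyclic_run[of "[al, ao, aq]" E \<kappa> 1] by (simp add: linked_sym[of E \<kappa> aq])
  show "linked E \<kappa> aq bl"
    using linked_of_cyclic_run[of "[aq, bq, bo, bl]" E \<kappa> 0] by simp
  show "linked E \<kappa> bq ao"
    using linked_of_cyclic_run[of "[ao, aq, bq]" E \<kappa> 2] by (simp add: linked_sym[of E \<kappa> bq])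
  show "linked E \<kappa> bq bo"
    using linked_of_cyclic_run[of "[bq, bo]" E \<kappa> 1] by simp
  show "linked E \<kappa> bq ap"
    using linked_of_cyclic_run[of "[bq, bo, bp, bk, ak, ap]" E \<kappa> 1] by simp
  show "linked E \<kappa> bq bp"
    using linked_of_cyclic_run[of "[bq, bo, bp]" E \<kappa> 1] by simp
  show "linked E \<kappa> bq ak"
    using linked_of_cyclic_run[of "[bq, bo, bp, bk, ak]" E \<kappa> 1] by simp
  show "linked E \<kappa> bq bk"
    using linked_of_cyclic_run[of "[bq, bo, bp, bk]" E \<kappa> 1] by simp
  show "linked E \<kappa> bq al"
    using linked_of_cyclic_run[of "[bq, bo, bl, al]" E \<kappa> 1] by simp
  show "linked E \<kappa> bq bl"
    using linked_of_cyclic_run[of "[bq, bo, bl]" E \<kappa> 1] by simp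
  show "linked E \<kappa> aq bq"
    using linked_of_cyclic_run[of "[aq, bq]" E \<kappa> 0] by simp
qed

lemma linked_leaves:
  assumes "distinct [ao, bo, al, bl, aq, bq, ax, bx]"
    and "colored_edge E \<kappa> ao bo 1"
      "colored_edge E \<kappa> al bl 0"
      "colored_edge E \<kappa> aq bq 0"
      "colored_edge E \<kappa> ax bx 0"
      "colored_edge E \<kappa> al ao 1"
      "colored_edge E \<kappa> bl bo 2"
      "colored_edge E \<kappa> aq ao 2"
      "colored_edge E \<kappa> bq bo 1"
      "colored_edge E \<kappa> ax ao 2"
      "colored_edge E \<kappa> bx bo 1"
  shows "linked E \<kappa> aq ax"
    and "linked E \<kappa> aq bx"
    and "linked E \<kappa> bq ax"
    and "linked E \<kappa> bq bx"
proof -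
  have "distinct [bx, ax, bq, aq, bl, al, bo, ao]"
    using assms(1) by auto
  note [simp] = assms(1)[simplified] this[simplified] assms(2-)[unfolded colored_edge_def]
  \<comment> \<open>The walk \<open>aq\<close>, \<open>ao\<close>, \<open>ax\<close> would repeat
    color 2. The detour crosses from copy \<open>a\<close> to copy \<open>b\<close> at
    \<open>aq\<close> and returns across the exceptional leaf, whose colors run in the opposite
    sense.\<close>
  show "linked E \<kappa> aq ax"
    using linked_of_cyclic_run[of "[aq, bq, bo, bl, al, ao, ax]" E \<kappa> 0] by simp
  show "linked E \<kappa> aq bx"
    using linked_of_cyclic_run[of "[bx, bo, bl, al, ao, aq]" E \<kappa> 1] by (simp add: linked_sym[of E \<kappa> aq])
  show "linked E \<kappa> bq ax"
    using linked_of_cyclic_run[of "[bq, bo, bl, al, ao, ax]" E \<kappa> 1] by simp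
  show "linked E \<kappa> bq bx"
    using linked_of_cyclic_run[of "[bq, bo, bl, al, ao, ax, bx]" E \<kappa> 1] by simp
qed

text \<open>In K2 the only level besides 0 is 1, so in column \<open>A\<close> a vertex on level 1
  has no complement. If it has a child, the path can return through that child, which is on level 2;
  if it is a leaf, it cannot, and the colors around such leaves are changed.\<close>

lemma cyclically_colorable_K2:
  assumes G: "pair_graph G" "pverts G = {A, B}" "A \<noteq> B" "(A, B) \<in> parcs G"
    and H: "pair_graph H" "rooted_spanning_tree H r par lev" "\<And>v. v \<in> pverts H \<Longrightarrow> lev v \<le> 2"
      "k0 \<in> pverts H" "lev k0 = 2"
  shows "cyclically_colorable (G \<box> H) 3"
proof -
  interpret G: pair_graph G by fact
  interpret H: pair_graph H by fact
  interpret GH: pair_graph "G \<box> H" using G H by (simp add: pair_graph_cartesian_product)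
  interpret T: rooted_tree "pverts H" r par lev using H by (simp add: rooted_spanning_tree_def)
  define inner where "inner v \<longleftrightarrow> (\<exists>k\<in>pverts H. lev k = 2 \<and> par k = v)" for v
  define Q where "Q = {v \<in> pverts H. lev v = 1 \<and> \<not> inner v}"
  define q0 where "q0 = (SOME q. q \<in> Q)"
  \<comment> \<open>Off \<open>Q\<close>, the lists give the general tree coloring by level, with
    \<open>A\<close> on level 0 and \<open>B\<close> on level 1; in \<open>colA\<close> and
    \<open>colB\<close> the entry for level 0 is a filler. Around an ordinary leaf the cyclic order
    2, 0, 1 leads from \<open>(A, r)\<close> to \<open>(B, r)\<close>, around \<open>q0\<close> it
    leads back.\<close>
  define lat where "lat v = (if v \<notin> Q then [1, 2, 1] ! lev v else 0 :: int)" for v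
  define colA where "colA v = (if v \<notin> Q then [0, 0, 2] ! lev v else if v = q0 then 1 else 2 :: int)" for v
  define colB where "colB v = (if v \<notin> Q then [0, 2, 0] ! lev v else if v = q0 then 2 else 1 :: int)" for v
  \<comment> \<open>A color inside a copy is determined by the end on the higher level;
    \<open>r\<close> stands in when both levels are equal, which happens for no tree edge.\<close>
  define \<kappa> where "\<kappa> = (\<lambda>(u, v) (x, y). if v = y then lat v else if u = x then
      let z = (if lev v < lev y then y else if lev y < lev v then v else r) in
      if u = A then colA z else colB z else 0)"
  let ?E = "\<lambda>x y. (x, y) \<in> parcs (G \<box> H)"
  let ?V = "pverts H - Q"
  have sym: "\<kappa> x y = \<kappa> y x" for x y
    by (auto simp: \<kappa>_def split: prod.splits)
  have q0: "q0 \<in> Q" if "q \<in> Q" for q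
    unfolding q0_def using that by (rule someI)
  have range: "\<kappa> x y \<in> {0..<3}" if "?E x y" for x y
  proof -
    have "lat v \<in> {0..<3}" "colA v \<in> {0..<3}" "colB v \<in> {0..<3}" if "v \<in> pverts H" for v
      using H(3)[OF that] by (auto simp: lat_def colA_def colB_def nth_Cons' numeral_2_eq_2)
    then show ?thesis
      using that T.root_in by (cases x; cases y) (auto simp: \<kappa>_def Let_def cartesian_product_def)
  qed
  have AB: "(B, A) \<in> parcs G" using G.arcs_symmetric G(4) .
  have par: "(v, par v) \<in> parcs H" "(par v, v) \<in> parcs H" if "v \<in> pverts H" "v \<noteq> r" for v
    using H(2) that H.arcs_symmetric by (auto simp: rooted_spanning_tree_def)
  note iff = parcs_cartesian_product_iff[OF G(1) H(1)]
  have par_less: "lev (par v) < lev v" "v \<noteq> par v" if "v \<in> pverts H" "v \<noteq> r" for v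
    using T.lev_par[OF that] by (simp, metis n_not_Suc_n)
  have lat: "colored_edge ?E \<kappa> (A, v) (B, v) (lat v)" if "v \<in> pverts H" for v
    using that G AB by (simp add: colored_edge_def iff \<kappa>_def)
  have colA: "colored_edge ?E \<kappa> (A, v) (A, par v) (colA v)" if "v \<in> pverts H" "v \<noteq> r" for v
    using that G par[OF that] par_less[OF that] by (auto simp: colored_edge_def iff \<kappa>_def)
  have colB: "colored_edge ?E \<kappa> (B, v) (B, par v) (colB v)" if "v \<in> pverts H" "v \<noteq> r" for v
    using that G par[OF that] par_less[OF that] by (auto simp: colored_edge_def iff \<kappa>_def)
  have par_r: "par v = r" if "v \<in> pverts H" "lev v = 1" for v
    using that T.lev_par[of v] T.lev_root T.lev_eq_0_iff[OF T.par_in, of v] by force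
  have level2: "inner (par k)" "par k \<in> pverts H" "lev (par k) = 1" "k \<noteq> r" "par k \<noteq> r" "k \<noteq> par k" 
      "par (par k) = r" "par k \<notin> Q" "k \<notin> Q"
    if "k \<in> pverts H" "lev k = 2" for k
  proof -
    show 1: "k \<noteq> r" using that T.lev_root by auto
    show 2: "inner (par k)" using that by (auto simp: inner_def)
    show 3: "par k \<in> pverts H" using T.par_in that 1 by blast
    show 4: "lev (par k) = 1" using T.lev_par[OF that(1) 1] that by simp
    show "par k \<noteq> r" using 4 T.lev_root by auto
    show "k \<noteq> par k" using 4 that by auto
    show "par (par k) = r" using par_r 3 4 by blast
    show "par k \<notin> Q" "k \<notin> Q" using 2 that by (auto simp: Q_def)
  qed
  have leaf: "q \<in> pverts H" "lev q = 1" "q \<noteq> r" "par q = r" if "q \<in> Q" for q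
    using that par_r T.lev_root by (auto simp: Q_def)
  have r: "r \<notin> Q" "lat r = 1" using T.lev_root by (auto simp: Q_def lat_def)
  have k: "lat k = 1" "colA k = 2" "colB k = 0" if "k \<in> pverts H" "lev k = 2" for k
    using that level2[of k] by (auto simp: lat_def colA_def colB_def)
  have p: "lat (par k) = 2" "colA (par k) = 0" "colB (par k) = 2" if "k \<in> pverts H" "lev k = 2" for k
    using that level2[of k] by (auto simp: lat_def colA_def colB_def)
  have q: "lat q = 0" "colA q = (if q = q0 then 1 else 2)" "colB q = (if q = q0 then 2 else 1)" if "q \<in> Q" for q
    using that by (auto simp: lat_def colA_def colB_def)
  have edges_r: "colored_edge ?E \<kappa> (A, r) (B, r) 1"
    using lat[OF T.root_in] r by simp
  have edges_k: "colored_edge ?E \<kappa> (A, par k) (B, par k) 2" "colored_edge ?E \<kappa> (A, k) (B, k) 1"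
      "colored_edge ?E \<kappa> (A, par k) (A, r) 0" "colored_edge ?E \<kappa> (B, par k) (B, r) 2"
      "colored_edge ?E \<kappa> (A, k) (A, par k) 2" "colored_edge ?E \<kappa> (B, k) (B, par k) 0"
    if "k \<in> pverts H" "lev k = 2" for k
    using lat[of k] lat[of "par k"] colA[of k] colA[of "par k"] colB[of k] colB[of "par k"]
      level2[OF that] k[OF that] p[OF that] that by simp_all
  have edges_q: "colored_edge ?E \<kappa> (A, q) (B, q) 0"
      "colored_edge ?E \<kappa> (A, q) (A, r) (if q = q0 then 1 else 2)"
      "colored_edge ?E \<kappa> (B, q) (B, r) (if q = q0 then 2 else 1)"
    if "q \<in> Q" for q
    using lat[of q] colA[of q] colB[of q] leaf[OF that] q[OF that] by simp_all
  have edges_q0: "colored_edge ?E \<kappa> (A, q0) (A, r) 1" "colored_edge ?E \<kappa> (B, q0) (B, r) 2"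
    if "q0 \<in> Q" using edges_q[OF that] by simp_all
  have edges_q': "colored_edge ?E \<kappa> (A, q) (A, r) 2" "colored_edge ?E \<kappa> (B, q) (B, r) 1"
    if "q \<in> Q" "q \<noteq> q0" for q using edges_q[OF that(1)] that(2) by simp_all

  \<comment> \<open>Every vertex off \<open>Q\<close> is the root, some \<open>k\<close> on level 2
    or its parent, so these finitely many configurations suffice.\<close>
  have leaf_linked: "linked ?E \<kappa> (u, q) (x, z) \<and> linked ?E \<kappa> (A, q) (B, q) \<and>
      (q \<noteq> q0 \<longrightarrow> linked ?E \<kappa> (u, q) (x, q0))"
    if k: "k \<in> pverts H" "lev k = 2" and q: "q \<in> Q" and z: "z \<in> {r, par k, k}"
      and ux: "u \<in> {A, B}" "x \<in> {A, B}" for q k z u x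
  proof (cases "q = q0")
    case True
    have "q0 \<in> Q" using q q0 by blast
    then have d: "distinct [(A, r), (B, r), (A, par k), (B, par k), (A, k), (B, k), (A, q0), (B, q0)]"
      using level2[OF k] leaf[of q0] G(3) by auto
    show ?thesis
      using linked_first_leaf[OF d edges_r edges_k(1,2)[OF k] edges_q(1)[OF \<open>q0 \<in> Q\<close>]
        edges_k(3,4)[OF k] edges_k(5,6)[OF k] edges_q0[OF \<open>q0 \<in> Q\<close>]] z ux True by auto
  next
    case False
    have "q0 \<in> Q" using q q0 by blast
    then have d: "distinct [(A, r), (B, r), (A, par k), (B, par k), (A, k), (B, k), (A, q0), (B, q0), (A, q), (B, q)]"
      using level2[OF k] leaf[of q0] leaf[OF q] G(3) False q by auto
    show ?thesis
      using linked_leaf[OF d edges_r edges_k(1,2)[OF k] edges_q(1)[OF \<open>q0 \<in> Q\<close>] edges_q(1)[OF q]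
        edges_k(3,4)[OF k] edges_k(5,6)[OF k] edges_q0[OF \<open>q0 \<in> Q\<close>] edges_q'[OF q False]] z ux False by auto
  qed
  have leaves_linked: "linked ?E \<kappa> (u, q) (x, q')"
    if q: "q \<in> Q" "q' \<in> Q" "q \<noteq> q'" and ux: "u \<in> {A, B}" "x \<in> {A, B}" for q q' u x
  proof -
    consider "q' = q0" | "q = q0" | "q \<noteq> q0" "q' \<noteq> q0" by blast
    then show ?thesis
    proof cases
      case 1
      then show ?thesis using leaf_linked[OF H(4,5) q(1) _ ux, of r] q by simp
    next
      case 2
      then show ?thesis
        using leaf_linked[OF H(4,5) q(2) _ ux(2,1), of r] q linked_sym[of ?E \<kappa> "(u, q)"] by simp
    next
      case 3
      have "q0 \<in> Q" using q q0 by blast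
      then have d: "distinct [(A, r), (B, r), (A, q0), (B, q0), (A, q), (B, q), (A, q'), (B, q')]"
        using leaf[of q0] leaf[OF q(1)] leaf[OF q(2)] G(3) 3 q by auto
      show ?thesis
        using linked_leaves[OF d edges_r edges_q(1)[OF \<open>q0 \<in> Q\<close>] edges_q(1)[OF q(1)] edges_q(1)[OF q(2)]
          edges_q0[OF \<open>q0 \<in> Q\<close>] edges_q'[OF q(1) 3(1)] edges_q'[OF q(2) 3(2)]] ux by auto
    qed
  qed
  have kid: "\<exists>k\<in>pverts H. lev k = 2 \<and> z \<in> {r, par k, k}" if z: "z \<in> ?V" for z
  proof -
    consider "lev z = 0" | "lev z = 1" | "lev z = 2" using H(3)[of z] z by fastforce
    then show ?thesis
    proof cases
      case 1
      then show ?thesis using T.lev_eq_0_iff z H(4,5) by blast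
    next
      case 2
      then show ?thesis using z by (auto simp: Q_def inner_def)
    qed (use z in blast)
  qed
  \<comment> \<open>Without the leaves in \<open>Q\<close> there is still a tree, as parents of
    vertices on level 2 are not in \<open>Q\<close>, and on it \<open>\<kappa>\<close> agrees with
    the general coloring.\<close>
  interpret P: tree_product "{A, B}" A "\<lambda>_. A" "\<lambda>u. if u = A then 0 else 1" ?V r par lev ?E \<kappa> False
  proof (intro tree_product.intro rooted_tree.intro tree_product_axioms.intro)
    fix v assume "v \<in> ?V" "v \<noteq> r"
    then obtain k where "k \<in> pverts H" "lev k = 2" "v \<in> {par k, k}" using kid by blast
    then show "par v \<in> ?V" using level2 r T.root_in by auto
  next
    fix u v assume "u \<in> {A, B}" "u \<noteq> A" "v \<in> ?V" "v \<noteq> r"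
    then show "\<kappa> (u, v) (A, v) = (1 - int (if u = A then 0 else 1) - int (lev v)) mod 3"
      using G(3) k p level2 kid[of v] by (auto simp: \<kappa>_def)
  next
    fix v assume "v \<in> ?V" "v \<noteq> r"
    then show "\<kappa> (A, v) (A, par v) = (1 - int (lev v)) mod 3"
      using edges_k kid[of v] level2 by (auto simp: colored_edge_def)
  next
    fix u v assume "u \<in> {A, B}" "u \<noteq> A" "v \<in> ?V" "v \<noteq> r"
    then show "\<kappa> (u, v) (u, par v) = (int (if u = A then 0 else 1) + int (lev v)) mod 3"
      using edges_k kid[of v] level2 by (auto simp: colored_edge_def)
  qed (use r T.root_in T.lev_root T.lev_par G AB par sym GH.arcs_symmetric in \<open>auto simp: iff \<kappa>_def\<close>)
  have V_linked: "linked ?E \<kappa> (u, v) (x, z)"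
    if "u \<in> {A, B}" "v \<in> ?V" "x \<in> {A, B}" "z \<in> ?V" "(u, v) \<noteq> (x, z)" for u v x z
  proof (rule P.all_linked[OF _ _ that])
    fix u x assume "u \<in> {A, B}" "x \<in> {A, B}" "u \<noteq> A" "x \<noteq> A" "u \<noteq> x"
    then show "linked ?E \<kappa> (u, r) (x, r)" by simp
  next
    fix v z assume vz: "v \<in> ?V" "z \<in> ?V" "v \<noteq> r" "z \<noteq> r" "z \<notin> P.T2.anc v"
    obtain k where k: "k \<in> pverts H" "lev k = 2" "z \<in> {par k, k}" using kid vz by blast
    show "linked ?E \<kappa> (A, v) (A, z)"
    \<comment> \<open>The levels of \<open>k\<close> and \<open>B\<close> add up to 3, so
      \<open>k\<close> itself is reached directly, and its parent through \<open>k\<close>.\<close>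
    proof (cases "z = k")
      case True
      then show ?thesis using P.column_linked[OF vz, of B] k G(3) by (simp add: numeral_3_eq_3)
    next
      case False
      then show ?thesis using P.column_linked_via[of v k B] k G(3) vz level2[OF k(1,2)] by (simp add: numeral_3_eq_3)
    qed
  qed
  have "linked ?E \<kappa> (u, v) (x, z)"
    if m: "u \<in> {A, B}" "v \<in> pverts H" "x \<in> {A, B}" "z \<in> pverts H" "(u, v) \<noteq> (x, z)" for u v x z
  proof (cases "v \<in> Q"; cases "z \<in> Q")
    assume "v \<in> Q" "z \<in> Q"
    then show ?thesis
    proof (cases "v = z")
      case True
      then show ?thesis
        using leaf_linked[OF H(4,5) \<open>v \<in> Q\<close>, of r A A] m linked_sym[of ?E \<kappa> "(B, v)" "(A, v)"] by auto
    qed (use leaves_linked m in blast)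
  next
    assume "v \<in> Q" "z \<notin> Q"
    then show ?thesis using kid[of z] leaf_linked[of _ v z u x] m by blast
  next
    assume "v \<notin> Q" "z \<in> Q"
    then show ?thesis using kid[of v] leaf_linked[of _ z v x u] m linked_sym[of ?E \<kappa> "(u, v)"] by blast
  qed (use V_linked m in blast)
  then show ?thesis unfolding cyclically_colorable_def
    by (intro exI[of _ \<kappa>]) (use sym range in \<open>auto simp: cartesian_product_def[of G H] G(2)\<close>)
qed

section \<open>Spanning trees with prescribed levels, and graphs without a path on four
  vertices\<close>

lemma reachable_of_connected:
  assumes "pair_graph F" "Digraph_Component.connected (with_proj F)" "x \<in> pverts F" "y \<in> pverts F"
  shows "reachable (with_proj F) x y"
proof -
  interpret F: pair_graph F by fact
  have "mk_symmetric (with_proj F) = F"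
    using F.graph_symmetric by (auto simp: mk_symmetric_def intro!: pair_pre_digraph.equality)
  then show ?thesis
    using assms by (auto simp: connected_def strongly_connected_def)
qed

lemma boundary_arc:
  assumes F: "pair_graph F" "Digraph_Component.connected (with_proj F)"
    and S: "S \<subseteq> pverts F" "S \<noteq> {}" "S \<noteq> pverts F"
  obtains s x where "s \<in> S" "x \<in> pverts F" "x \<notin> S" "(s, x) \<in> parcs F" "(x, s) \<in> parcs F"
proof -
  interpret F: pair_graph F by fact
  obtain a z where a: "a \<in> S" and z: "z \<in> pverts F" "z \<notin> S" using S by blast
  obtain p where p: "F.awalk a p z"
    using reachable_of_connected[OF F, of a z] a z S F.reachable_awalk by blast
  have "\<exists>s x. s \<in> S \<and> x \<notin> S \<and> (s, x) \<in> parcs F"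
    using p a z(2)
  proof (induction p arbitrary: a)
    case (Cons e p)
    then show ?case
      by (cases e; cases "snd e \<in> S") (auto simp: F.awalk_Cons_iff)
  qed (auto simp: F.awalk_Nil_iff)
  then show ?thesis using that F.in_arcsD2 F.arcs_symmetric by metis
qed

text \<open>New vertices are hung one by one on the current tree across a boundary arc, which leaves
  all levels assigned earlier unchanged.\<close>

lemma extend_rooted_tree:
  assumes F: "pair_graph F" "Digraph_Component.connected (with_proj F)"
    and "S \<subseteq> pverts F" "rooted_tree S r par lev" "\<And>v. v \<in> S \<Longrightarrow> v \<noteq> r \<Longrightarrow> (v, par v) \<in> parcs F"
  shows "\<exists>par' lev'. rooted_spanning_tree F r par' lev' \<and> (\<forall>v\<in>S. lev' v = lev v)"
  using assms(3-5)
proof (induction "card (pverts F - S)" arbitrary: S par lev rule: less_induct)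
  case less
  interpret F: pair_graph F by fact
  interpret T: rooted_tree S r par lev by fact
  show ?case
  proof (cases "S = pverts F")
    case True
    then show ?thesis using less by (auto simp: rooted_spanning_tree_def)
  next
    case False
    obtain s x where sx: "s \<in> S" "x \<in> pverts F" "x \<notin> S" "(x, s) \<in> parcs F"
      using boundary_arc[OF F less.prems(1) _ False] T.root_in by blast
    let ?par = "par(x := s)" and ?lev = "lev(x := Suc (lev s))"
    have "rooted_tree (insert x S) r ?par ?lev"
      using sx T.root_in T.lev_root T.par_in T.lev_par by unfold_locales (auto split: if_splits)
    moreover have "(v, ?par v) \<in> parcs F" if "v \<in> insert x S" "v \<noteq> r" for v
      using that less.prems(3) sx by auto
    moreover have "card (pverts F - insert x S) < card (pverts F - S)"
      using sx F.pair_finite_verts by (intro psubset_card_mono) auto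
    ultimately obtain par' lev' where "rooted_spanning_tree F r par' lev'" "\<forall>v\<in>insert x S. lev' v = ?lev v"
      using less.hyps[of "insert x S" ?par ?lev] less.prems(1) sx by auto
    moreover from this have "\<forall>v\<in>S. lev' v = lev v" using sx by auto
    ultimately show ?thesis by blast
  qed
qed

text \<open>The path is a subgraph and need not be induced.\<close>

definition has_P4 :: "'a pair_pre_digraph \<Rightarrow> bool" where
  "has_P4 F \<longleftrightarrow> (\<exists>a b c d. distinct [a, b, c, d] \<and> (a, b) \<in> parcs F \<and> (b, c) \<in> parcs F \<and> (c, d) \<in> parcs F)"

lemma deep_spanning_tree:
  assumes F: "pair_graph F" "Digraph_Component.connected (with_proj F)" and "has_P4 F"
  obtains r par lev v where "rooted_spanning_tree F r par lev" "v \<in> pverts F" "lev v = 3"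
proof -
  interpret F: pair_graph F by fact
  obtain a b c d where d: "distinct [a, b, c, d]" and e: "(a, b) \<in> parcs F" "(b, c) \<in> parcs F" "(c, d) \<in> parcs F"
    using assms(3) unfolding has_P4_def by blast
  let ?par = "\<lambda>v. if v = b then a else if v = c then b else c"
  let ?lev = "\<lambda>v. if v = a then 0 else if v = b then 1 else if v = c then 2 else 3 :: nat"
  have "rooted_tree {a, b, c, d} a ?par ?lev"
    using d by unfold_locales auto
  moreover have "{a, b, c, d} \<subseteq> pverts F" using e by (auto dest: F.in_arcsD1 F.in_arcsD2)
  moreover have "(v, ?par v) \<in> parcs F" if "v \<in> {a, b, c, d}" "v \<noteq> a" for v
    using that d e F.arcs_symmetric by auto
  ultimately have "\<exists>par lev. rooted_spanning_tree F a par lev \<and> (\<forall>v\<in>{a, b, c, d}. lev v = ?lev v)"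
    by (intro extend_rooted_tree[OF F])
  then obtain par lev where "rooted_spanning_tree F a par lev" "\<forall>v\<in>{a, b, c, d}. lev v = ?lev v"
    by blast
  then show ?thesis using that[of a par lev d] d \<open>{a, b, c, d} \<subseteq> pverts F\<close> by auto
qed

text \<open>With three or more vertices, some \<open>b\<close> has two neighbors. An arc from
  \<open>s\<close> to \<open>t\<close> leaving its closed neighborhood, together with a neighbor
  \<open>w\<close> other than \<open>s\<close>, would give the path \<open>w\<close>,
  \<open>b\<close>, \<open>s\<close>, \<open>t\<close>.\<close>

lemma dominating_vertex:
  assumes F: "pair_graph F" "Digraph_Component.connected (with_proj F)" and "nontrivial F" "\<not> has_P4 F"
  obtains b where "b \<in> pverts F" "\<And>v. v \<in> pverts F \<Longrightarrow> v \<noteq> b \<Longrightarrow> (b, v) \<in> parcs F"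
proof -
  interpret F: pair_graph F by fact
  have irr: "(v, v) \<notin> parcs F" for v using F.pair_no_loops[of "(v, v)"] by auto
  obtain x where x: "x \<in> pverts F" using assms(3) by (fastforce simp: nontrivial_def)
  have "card {x} < card (pverts F)" using assms(3) by (simp add: nontrivial_def)
  then have "{x} \<noteq> pverts F" by (metis less_irrefl)
  then obtain y where y: "y \<in> pverts F" "y \<noteq> x" "(x, y) \<in> parcs F"
    using boundary_arc[OF F, of "{x}"] x by auto
  show ?thesis
  proof (cases "pverts F = {x, y}")
    case True
    then show ?thesis using that[of x] y by auto
  next
    case False
    obtain b z where b: "b \<in> {x, y}" "z \<in> pverts F" "z \<notin> {x, y}" "(b, z) \<in> parcs F"
    proof (rule boundary_arc[OF F, of "{x, y}"])
      show "{x, y} \<subseteq> pverts F" "{x, y} \<noteq> {}" "{x, y} \<noteq> pverts F" using x y False by auto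
    qed (use that in blast)
    have "(y, x) \<in> parcs F" using y F.arcs_symmetric by blast
    then have "(b, if b = x then y else x) \<in> parcs F" using b(1) y(3) by auto
    moreover have "(if b = x then y else x) \<noteq> z" using b(3) by auto
    ultimately obtain c where c: "b \<in> pverts F" "c \<noteq> z" "(b, c) \<in> parcs F" "(b, z) \<in> parcs F"
      using F.in_arcsD1[OF b(4)] b(4) by metis
    define S where "S = insert b {v. (b, v) \<in> parcs F}"
    have S: "S \<subseteq> pverts F" using c by (auto simp: S_def dest: F.in_arcsD2)
    have "S = pverts F"
    proof (rule ccontr)
      assume "S \<noteq> pverts F"
      moreover have "S \<noteq> {}" by (simp add: S_def)
      ultimately obtain s t where st: "s \<in> S" "t \<notin> S" "(s, t) \<in> parcs F"
        using boundary_arc[OF F S] by metis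
      then have s: "s \<noteq> b" "(b, s) \<in> parcs F" by (auto simp: S_def)
      obtain w where w: "w \<noteq> s" "(b, w) \<in> parcs F" using c by metis
      have "distinct [w, b, s, t]" using s w st irr by (auto simp: S_def)
      then have "has_P4 F" unfolding has_P4_def using s w st F.arcs_symmetric by blast
      then show False using assms by blast
    qed
    then show ?thesis using that[of b] c by (auto simp: S_def)
  qed
qed

text \<open>If two neighbors \<open>a\<close>, \<open>b\<close> of the dominating vertex
  \<open>c\<close> are adjacent, a further vertex \<open>d\<close> would give the path
  \<open>d\<close>, \<open>c\<close>, \<open>b\<close>, \<open>a\<close>; if no two are,
  \<open>c\<close> is the center of a star.\<close>

lemma star_or_triangle:
  assumes F: "pair_graph F" "Digraph_Component.connected (with_proj F)" and "nontrivial F" "\<not> has_P4 F"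
  shows "star_graph F \<or> (\<exists>c a b. pverts F = {c, a, b} \<and> a \<noteq> b \<and> a \<noteq> c \<and> b \<noteq> c \<and>
    (a, c) \<in> parcs F \<and> (b, a) \<in> parcs F \<and> (b, c) \<in> parcs F)"
proof -
  interpret F: pair_graph F by fact
  have irr: "(v, v) \<notin> parcs F" for v using F.pair_no_loops[of "(v, v)"] by auto
  obtain c where c: "c \<in> pverts F" "\<And>v. v \<in> pverts F \<Longrightarrow> v \<noteq> c \<Longrightarrow> (c, v) \<in> parcs F"
    using dominating_vertex[OF assms] by metis
  show ?thesis
  proof (cases "\<exists>a b. (b, a) \<in> parcs F \<and> a \<noteq> c \<and> b \<noteq> c")
    case True
    then obtain a b where ab: "(b, a) \<in> parcs F" "a \<noteq> c" "b \<noteq> c" by blast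
    then have m: "a \<in> pverts F" "b \<in> pverts F" "a \<noteq> b" using irr by (auto dest: F.in_arcsD1 F.in_arcsD2)
    then have "(a, c) \<in> parcs F" "(b, c) \<in> parcs F" using c ab F.arcs_symmetric by blast+
    moreover have "pverts F = {c, a, b}"
    proof (rule ccontr)
      assume "pverts F \<noteq> {c, a, b}"
      then obtain d where "d \<in> pverts F" "d \<notin> {c, a, b}" using m c by blast
      then have "distinct [d, c, b, a]" "(d, c) \<in> parcs F" "(c, b) \<in> parcs F"
        using c m ab F.arcs_symmetric by auto
      then show False using assms(4) ab unfolding has_P4_def by blast
    qed
    ultimately show ?thesis using ab m by blast
  next
    case False
    have arcs: "parcs F = {c} \<times> (pverts F - {c}) \<union> (pverts F - {c}) \<times> {c}"
    proof (intro equalityI subsetI)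
      fix e assume "e \<in> parcs F"
      then show "e \<in> {c} \<times> (pverts F - {c}) \<union> (pverts F - {c}) \<times> {c}"
        using False irr by (cases e) (auto dest: F.in_arcsD1 F.in_arcsD2)
    next
      fix e assume "e \<in> {c} \<times> (pverts F - {c}) \<union> (pverts F - {c}) \<times> {c}"
      then show "e \<in> parcs F" using c F.arcs_symmetric by auto
    qed
    have "graph (with_proj F)" by unfold_locales
    moreover have "verts (with_proj F) = {c} \<union> (pverts F - {c})" using c(1) by auto
    moreover have "arcs_ends (with_proj F) = {c} \<times> (pverts F - {c}) \<union> (pverts F - {c}) \<times> {c}"
      unfolding arcs[symmetric] by simp
    ultimately have "complete_bipartite_digraph 1 (card (pverts F - {c})) (with_proj F)"
      unfolding complete_bipartite_digraph_def by (metis Diff_disjoint card_1_singleton_iff One_nat_def)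
    moreover have "card (pverts F - {c}) \<ge> 1"
      using assms(3) c F.pair_finite_verts by (simp add: nontrivial_def)
    ultimately show ?thesis unfolding star_graph_def by blast
  qed
qed

text \<open>The height is exactly 2, because a vertex on level 2 must be there as the complement of
  level 1.\<close>

definition has_depth2_tree :: "'a pair_pre_digraph \<Rightarrow> bool" where
  "has_depth2_tree F \<longleftrightarrow> (\<exists>r par lev. rooted_spanning_tree F r par lev \<and> (\<forall>v\<in>pverts F. lev v \<le> 2) \<and>
     (\<exists>v\<in>pverts F. lev v = 2))"

lemma depth2_tree_of_eccentricity:
  assumes F: "pair_graph F" and card: "card (pverts F) \<ge> 3" and x: "x \<in> pverts F"
    and near: "\<And>y. y \<in> pverts F \<Longrightarrow> y \<noteq> x \<Longrightarrow> (x, y) \<notin> parcs F \<Longrightarrow> \<exists>m. (x, m) \<in> parcs F \<and> (m, y) \<in> parcs F"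
  shows "has_depth2_tree F"
proof -
  interpret F: pair_graph F by fact
  have irr: "(v, v) \<notin> parcs F" for v using F.pair_no_loops[of "(v, v)"] by auto
  show ?thesis
  proof (cases "\<exists>y\<in>pverts F. y \<noteq> x \<and> (x, y) \<notin> parcs F")
    case True
    obtain m where m: "\<And>y. y \<in> pverts F \<Longrightarrow> y \<noteq> x \<Longrightarrow> (x, y) \<notin> parcs F \<Longrightarrow> (x, m y) \<in> parcs F \<and> (m y, y) \<in> parcs F"
      using near by metis
    define par where "par y = (if (x, y) \<in> parcs F then x else m y)" for y
    define lev where "lev y = (if y = x then 0 else if (x, y) \<in> parcs F then 1 else 2 :: nat)" for y
    have "rooted_tree (pverts F) x par lev"
    proof
      fix v assume v: "v \<in> pverts F" "v \<noteq> x"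
      show "par v \<in> pverts F" using m[OF v] x by (auto simp: par_def dest: F.in_arcsD2)
      show "lev v = Suc (lev (par v))" using m[OF v] v irr by (auto simp: par_def lev_def)
    qed (auto simp: x lev_def)
    moreover have "(v, par v) \<in> parcs F" if "v \<in> pverts F" "v \<noteq> x" for v
      using m[OF that] F.arcs_symmetric by (auto simp: par_def)
    moreover have "lev v \<le> 2" for v by (simp add: lev_def)
    moreover have "\<exists>v\<in>pverts F. lev v = 2" using True by (auto simp: lev_def)
    ultimately show ?thesis unfolding has_depth2_tree_def rooted_spanning_tree_def by blast
  next
    case False
    have "\<not> pverts F \<subseteq> {x}"
      using card card_mono[of "{x}" "pverts F"] by auto
    then obtain y where y: "y \<in> pverts F" "y \<noteq> x" by blast
    have "\<not> pverts F \<subseteq> {x, y}"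
      using card card_mono[of "{x, y}" "pverts F"] y by auto
    then obtain z where z: "z \<in> pverts F" "z \<noteq> x" "z \<noteq> y" by blast
    \<comment> \<open>Rooted at the dominating vertex \<open>x\<close>, the tree would have height
      1; rooted at its neighbor \<open>y\<close>, it has \<open>z\<close> on level 2.\<close>
    define par where "par v = (if v = x then y else x)" for v
    define lev where "lev v = (if v = y then 0 else if v = x then 1 else 2 :: nat)" for v
    have "rooted_tree (pverts F) y par lev"
      using x y by unfold_locales (auto simp: par_def lev_def)
    moreover have "(v, par v) \<in> parcs F" if "v \<in> pverts F" "v \<noteq> y" for v
      using that False y F.arcs_symmetric by (auto simp: par_def)
    moreover have "lev v \<le> 2" for v by (simp add: lev_def)
    moreover have "lev z = 2" using z by (simp add: lev_def)
    ultimately show ?thesis unfolding has_depth2_tree_def rooted_spanning_tree_def using z by blast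
  qed
qed

text \<open>A center of \<open>T\<close> has all vertices within two steps in \<open>T\<close>,
  hence in \<open>H\<close>; the tree of height 2 is then built from adjacency in
  \<open>H\<close>.\<close>

lemma depth2_tree_of_radius:
  assumes H: "pair_graph H" and card: "card (pverts H) \<ge> 3"
    and T: "undirected_spanning_tree T H" "radius T < 3"
  shows "has_depth2_tree H"
proof -
  interpret H: pair_graph H by fact
  have T': "pair_graph T" "Digraph_Component.connected (with_proj T)"
    using T by (auto simp: undirected_spanning_tree_def undirected_tree_def)
  interpret T: pair_graph T by fact
  have V: "pverts T = pverts H" and A: "parcs T \<subseteq> parcs H"
    using T by (auto simp: undirected_spanning_tree_def spanning_def subgraph_def)
  let ?ecc = "\<lambda>x. Max ((\<lambda>y. distance T x y) ` pverts T)"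
  have ne: "pverts T \<noteq> {}" using card V by auto
  have "radius T \<in> ?ecc ` pverts T"
    unfolding radius_def using ne T.pair_finite_verts by (intro Min_in) auto
  then obtain x where x: "x \<in> pverts T" "?ecc x \<le> 2" using T(2) by fastforce
  show ?thesis
  proof (rule depth2_tree_of_eccentricity[OF H card])
    show "x \<in> pverts H" using x V by simp
    fix y assume y: "y \<in> pverts H" "y \<noteq> x" "(x, y) \<notin> parcs H"
    have "distance T x y \<le> ?ecc x" using y V T.pair_finite_verts by (intro Max_ge) auto
    then have d: "distance T x y \<le> 2" using x by simp
    have "\<exists>n p. T.apath x p y \<and> length p = n"
      using reachable_of_connected[OF T', of x y] x y V T.reachable_apath by simp
    then have "\<exists>p. T.apath x p y \<and> length p = distance T x y"
      unfolding distance_def by (rule LeastI_ex)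
    then obtain p where p: "T.awalk x p y" "length p \<le> 2" using d by (auto simp: T.apath_def)
    show "\<exists>m. (x, m) \<in> parcs H \<and> (m, y) \<in> parcs H"
    proof (cases p)
      case Nil
      then show ?thesis using p y by (simp add: T.awalk_Nil_iff)
    next
      case p1: (Cons e q)
      show ?thesis
      proof (cases q)
        case Nil
        then show ?thesis using p p1 y A by (cases e) (auto simp: T.awalk_simps)
      next
        case (Cons e' q')
        then show ?thesis using p p1 y A
          by (intro exI[of _ "snd e"]; cases e; cases e') (auto simp: T.awalk_simps)
      qed
    qed
  qed
qed

lemma two_vertices:
  assumes F: "pair_graph F" "Digraph_Component.connected (with_proj F)" "card (pverts F) = 2"
  obtains a b where "pverts F = {a, b}" "a \<noteq> b" "(a, b) \<in> parcs F"
proof -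
  obtain a b where ab: "pverts F = {a, b}" "a \<noteq> b" using F(3) by (auto simp: card_2_iff)
  then have "(a, b) \<in> parcs F" using boundary_arc[OF F(1,2), of "{a}"] by auto
  then show ?thesis using that ab by blast
qed

lemma complete_of_two_vertices:
  assumes F: "pair_graph F" "Digraph_Component.connected (with_proj F)" "card (pverts F) = 2"
  shows "complete_graph F"
proof -
  interpret F: pair_graph F by fact
  obtain a b where ab: "pverts F = {a, b}" "a \<noteq> b" "(a, b) \<in> parcs F" using two_vertices[OF F] by metis
  have irr: "(v, v) \<notin> parcs F" for v using F.pair_no_loops[of "(v, v)"] by auto
  have "(b, a) \<in> parcs F" using ab F.arcs_symmetric by blast
  then have "parcs F = {(u, v). (u, v) \<in> pverts F \<times> pverts F \<and> u \<noteq> v}"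
    using ab irr by (auto dest: F.in_arcsD1 F.in_arcsD2)
  then show ?thesis
    unfolding complete_graph_def complete_digraph_pair_def using F.pair_finite_verts by blast
qed

section \<open>The case distinction\<close>

lemma shallow_colorable:
  assumes G: "pair_graph G" "Digraph_Component.connected (with_proj G)" "nontrivial G"
    and H: "pair_graph H" and shallow: "card (pverts G) \<noteq> 2 \<Longrightarrow> has_depth2_tree G" "has_depth2_tree H"
  shows "cyclically_colorable (G \<box> H) 3"
proof -
  obtain r2 p2 l2 b where T2: "rooted_spanning_tree H r2 p2 l2" "\<And>v. v \<in> pverts H \<Longrightarrow> l2 v \<le> 2"
    "b \<in> pverts H" "l2 b = 2" using shallow(2) unfolding has_depth2_tree_def by blast
  show ?thesis
  proof (cases "card (pverts G) = 2")
    case True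
    obtain A B where "pverts G = {A, B}" "A \<noteq> B" "(A, B) \<in> parcs G"
      using two_vertices[OF G(1,2) True] by metis
    then show ?thesis using cyclically_colorable_K2[OF G(1) _ _ _ H T2] by blast
  next
    case False
    then obtain r1 p1 l1 a where T1: "rooted_spanning_tree G r1 p1 l1" "\<And>v. v \<in> pverts G \<Longrightarrow> l1 v \<le> 2"
      "a \<in> pverts G" "l1 a = 2" using shallow(1) unfolding has_depth2_tree_def by blast
    then show ?thesis using cyclically_colorable_depth2[OF G(1) T1 H T2] by blast
  qed
qed

lemma depth2_tree_of_no_P4:
  assumes F: "pair_graph F" "Digraph_Component.connected (with_proj F)" "nontrivial F" "\<not> has_P4 F"
    and "card (pverts F) \<noteq> 2"
  shows "has_depth2_tree F"
proof -
  obtain b where "b \<in> pverts F" "\<And>v. v \<in> pverts F \<Longrightarrow> v \<noteq> b \<Longrightarrow> (b, v) \<in> parcs F"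
    using dominating_vertex[OF F] by metis
  moreover have "card (pverts F) \<ge> 3" using F(3) assms(5) by (simp add: nontrivial_def)
  ultimately show ?thesis using depth2_tree_of_eccentricity[OF F(1)] by blast
qed

text \<open>The four-color alternative carries one half of condition (E) with it, so that it can
  arise only where four colors are allowed.\<close>

lemma one_deep_colorable:
  assumes G: "pair_graph G" "Digraph_Component.connected (with_proj G)" "nontrivial G" "\<not> has_P4 G"
    and H: "pair_graph H" "Digraph_Component.connected (with_proj H)" "has_P4 H"
  shows "cyclically_colorable (G \<box> H) 3 \<or> cyclically_colorable (G \<box> H) 4 \<and>
    star_graph G \<and> (\<forall>T. undirected_spanning_tree T H \<longrightarrow> radius T \<ge> 3)"
proof -
  interpret G: pair_graph G by fact
  interpret H: pair_graph H by fact
  obtain r2 p2 l2 d where T2: "rooted_spanning_tree H r2 p2 l2" "d \<in> pverts H" "l2 d = 3"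
    using deep_spanning_tree[OF H] by metis
  show ?thesis
  proof (cases "star_graph G")
    case False
    then show ?thesis
      using star_or_triangle[OF G] cyclically_colorable_triangle[OF G(1) _ _ _ _ _ _ _ H(1) T2] by metis
  next
    case star: True
    show ?thesis
    proof (cases "\<exists>T. undirected_spanning_tree T H \<and> radius T < 3")
      case True
      have "card (pverts H) \<ge> 3"
      proof -
        obtain a b c where "distinct [a, b, c]" "{a, b, c} \<subseteq> pverts H"
          using H(3) unfolding has_P4_def by (auto dest: H.in_arcsD1 H.in_arcsD2)
        then show ?thesis
          using card_mono[OF H.pair_finite_verts, of "{a, b, c}"] by simp
      qed
      \<comment> \<open>The tree with a vertex on level 3 is given up here for one of height 2,
        which suits the star.\<close>
      then have "has_depth2_tree H" using True depth2_tree_of_radius[OF H(1)] by blast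
      then show ?thesis using shallow_colorable[OF G(1-3) H(1)] depth2_tree_of_no_P4[OF G] by blast
    next
      case False
      obtain b where b: "b \<in> pverts G" "\<And>v. v \<in> pverts G \<Longrightarrow> v \<noteq> b \<Longrightarrow> (b, v) \<in> parcs G"
        using dominating_vertex[OF G] by metis
      have "rooted_tree (pverts G) b (\<lambda>_. b) (\<lambda>v. if v = b then 0 else 1)"
        using b by unfold_locales auto
      then have T1: "rooted_spanning_tree G b (\<lambda>_. b) (\<lambda>v. if v = b then 0 else 1)"
        using b G.arcs_symmetric by (auto simp: rooted_spanning_tree_def)
      have "\<not> pverts G \<subseteq> {b}"
        using G(3) card_mono[of "{b}" "pverts G"] by (auto simp: nontrivial_def)
      then obtain t where "t \<in> pverts G" "t \<noteq> b" by blast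
      then have "cyclically_colorable (G \<box> H) 4"
        using cyclically_colorable_wild[OF G(1) T1 H(1) T2(1) ex_complementary_level[OF T2], of t] by simp
      then show ?thesis using star False by (simp add: not_less)
    qed
  qed
qed

lemma neither_deep_colorable:
  assumes G: "pair_graph G" "Digraph_Component.connected (with_proj G)" "nontrivial G" "\<not> has_P4 G"
    and H: "pair_graph H" "Digraph_Component.connected (with_proj H)" "nontrivial H" "\<not> has_P4 H"
    and "\<not> (complete_graph G \<and> complete_graph H)"
  shows "cyclically_colorable (G \<box> H) 3"
proof (cases "card (pverts H) = 2")
  case True
  \<comment> \<open>Two factors with two vertices each would both be complete.\<close>
  then have "card (pverts G) \<noteq> 2"
    using complete_of_two_vertices[OF G(1,2)] complete_of_two_vertices[OF H(1,2)] assms(9) by blast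
  then have "cyclically_colorable (H \<box> G) 3"
    using shallow_colorable[OF H(1-3) G(1)] depth2_tree_of_no_P4[OF G] True by blast
  then show ?thesis using cyclically_colorable_swap G(1) H(1) by blast
next
  case False
  then show ?thesis
    using shallow_colorable[OF G(1-3) H(1)] depth2_tree_of_no_P4[OF G] depth2_tree_of_no_P4[OF H] by blast
qed

theorem theorem4p2:
  fixes G :: "'a pair_pre_digraph" and H :: "'b pair_pre_digraph"
  assumes "pair_graph G" and "pair_graph H"
    and "Digraph_Component.connected (with_proj G)"
    and "Digraph_Component.connected (with_proj H)"
    and "nontrivial G" and "nontrivial H"
    and "\<not> (complete_graph G \<and> complete_graph H)"
  shows "(\<not> condition_E G H \<longrightarrow> pc\<^sub>1\<^sub>2 (G \<box> H) = 3) \<and>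
         (condition_E G H \<longrightarrow> pc\<^sub>1\<^sub>2 (G \<box> H) \<le> 4)"
proof -
  note G = assms(1,3,5) and H = assms(2,4,6)
  have GH: "pair_graph (G \<box> H)" using assms by (simp add: pair_graph_cartesian_product)
  have "cyclically_colorable (G \<box> H) 3 \<or> cyclically_colorable (G \<box> H) 4 \<and> condition_E G H"
  proof (cases "has_P4 G"; cases "has_P4 H")
    assume P: "has_P4 G" "has_P4 H"
    obtain r1 p1 l1 a where T1: "rooted_spanning_tree G r1 p1 l1" "a \<in> pverts G" "l1 a = 3"
      using deep_spanning_tree[OF G(1,2) P(1)] by metis
    obtain r2 p2 l2 b where T2: "rooted_spanning_tree H r2 p2 l2" "b \<in> pverts H" "l2 b = 3"
      using deep_spanning_tree[OF H(1,2) P(2)] by metis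
    show ?thesis using cyclically_colorable_deep[OF G(1) T1 H(1) T2] by blast
  next
    assume P: "has_P4 G" "\<not> has_P4 H"
    show ?thesis
      using one_deep_colorable[OF H P(2) G(1,2) P(1)] cyclically_colorable_swap[OF H(1) G(1)]
      unfolding condition_E_def by blast
  next
    assume P: "\<not> has_P4 G" "has_P4 H"
    show ?thesis
      using one_deep_colorable[OF G P(1) H(1,2) P(2)] unfolding condition_E_def by blast
  next
    assume P: "\<not> has_P4 G" "\<not> has_P4 H"
    show ?thesis
      using neither_deep_colorable[OF G P(1) H P(2) assms(7)] by blast
  qed
  then show ?thesis
  proof
    assume c: "cyclically_colorable (G \<box> H) 3"
    \<comment> \<open>The coloring is needed for the lower bound as well, to make the minimum
      attained.\<close>
    obtain c where "proper_connecting_coloring (G \<box> H) c"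
      using proper_coloring_of_cyclic[OF GH c] by blast
    then have "3 \<le> pc\<^sub>1\<^sub>2 (G \<box> H)" using three_le_pc_product assms by blast
    then show ?thesis using pc_le_of_cyclic[OF GH c] by simp
  next
    assume "cyclically_colorable (G \<box> H) 4 \<and> condition_E G H"
    then show ?thesis using pc_le_of_cyclic[OF GH] by blast
  qed
qed

end
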